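(* Let $r$ be a positive integer. An $r$-dim linear Lie conformal superalgebra $R=\mathbb{C}[\mathbf{T}]V$ is equivalent to that $V=V_{\bar0}\oplus V_{\bar1}$ is equipped with one Lie superalgebraic operation $[\cdot,\cdot]$ and $r$ Novikov superalgebraic operations $\circ_i$ $(1\le i\le r)$ such that $(V,[\cdot,\cdot],\circ_i)$ is a super Gel'fand-Dorfman bialgebra for each $1\le i\le r$, and $\circ_i$ and $\circ_j$ satisfy the following conditions: $$a\circ_i(b\circ_j c)-(a\circ_i b)\circ_j c=(-1)^{\alpha\beta}\big[b\circ_j(a\circ_i c)-(b\circ_j a)\circ_i c\big],$$ $$(c\circ_i a)\circ_j b+(c\circ_j a)\circ_i b=(-1)^{\alpha\beta}\big[(c\circ_i b)\circ_j a+(c\circ_j b)\circ_i a\big],$$ for $a\in V_\alpha$, $b\in V_\beta$, $c\in V$ and $i\ne j$. Such $(V,[\cdot,\cdot],\circ_1,\dots,\circ_r)$ is called a generalized super Gel'fand-Dorfman algebra.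
   Context: The base field is $\mathbb{C}$; $\mathbf{T}=(T_1,\dots,T_r)$, $\lambda=(\lambda_1,\dots,\lambda_r)$ and $\mu=(\mu_1,\dots,\mu_r)$ are vectors of variables, $\mathbb{C}[\mathbf{T}]=\mathbb{C}[T_1,\dots,T_r]$, and $\mathbb{C}[\mathbf{T}]V=\mathbb{C}[\mathbf{T}]\otimes_{\mathbb{C}}V$ is the free $\mathbb{C}[\mathbf{T}]$-module over a $\mathbb{Z}/2\mathbb{Z}$-graded vector space $V$, graded by $V$. Operations on graded spaces are understood in the usual super sense (compatible with the grading). A Lie superalgebra is a $\mathbb{Z}/2\mathbb{Z}$-graded algebra $\mathfrak{g}=\mathfrak{g}_{\bar0}\oplus\mathfrak{g}_{\bar1}$ with an operation $[\cdot,\cdot]$ such that $[a,b]=-(-1)^{\alpha\beta}[b,a]$ and $[a,[b,c]]=[[a,b],c]+(-1)^{\alpha\beta}[b,[a,c]]$ for $a\in\mathfrak{g}_\alpha$, $b\in\mathfrak{g}_\beta$, $c\in\mathfrak{g}$. An $r$-dim Lie conformal superalgebra is a left $\mathbb{Z}/2\mathbb{Z}$-graded $\mathbb{C}[\mathbf{T}]$-module $R=R_{\bar0}\oplus R_{\bar1}$ with a $\lambda$-bracket, i.e. a $\mathbb{C}$-bilinear map $R\otimes R\to R[\lambda]=\mathbb{C}[\lambda_1,\dots,\lambda_r]\otimes R$, $a\otimes b\mapsto[a_\lambda b]$, such that for $1\le i\le r$, $a\in R_\alpha$, $b\in R_\beta$, $c\in R$: $[T_ia_\lambda b]=-\lambda_i[a_\lambda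 b]$ and $[a_\lambda T_ib]=(T_i+\lambda_i)[a_\lambda b]$; $[a_\lambda b]=-(-1)^{\alpha\beta}[b_{-(\lambda+\mathbf{T})}a]$; $[a_\lambda[b_\mu c]]=[[a_\lambda b]_{\lambda+\mu}c]+(-1)^{\alpha\beta}[b_\mu[a_\lambda c]]$. Here $[b_{-(\lambda+\mathbf{T})}a]$ means: write $[b_\nu a]=\sum_{\mathbf m}\nu^{\mathbf m}z_{\mathbf m}$ with $z_{\mathbf m}\in R$ and substitute $\nu=-\lambda-\mathbf{T}$, with $\mathbf{T}$ acting on the $z_{\mathbf m}$. An $r$-dim linear Lie conformal superalgebra is an $r$-dim Lie conformal superalgebra $R=\mathbb{C}[\mathbf{T}]V$, free as a $\mathbb{C}[\mathbf{T}]$-module over a $\mathbb{Z}/2\mathbb{Z}$-graded vector space $V$, such that for any $a,b\in V$ the $\lambda$-bracket has the form $[a_\lambda b]=\sum_{i=1}^r\lambda_iw_i+\sum_{j=1}^rT_ju_j+v$ with $u_j,w_i,v\in V$ (depending on $a,b$). A (left) Novikov superalgebra is a $\mathbb{Z}/2\mathbb{Z}$-graded vector space $A=A_{\bar0}\oplus A_{\bar1}$ with an operation $\circ$ such that for $a\in A_\alpha$, $b\in A_\beta$, $c\in A_\gamma$: $(a\circ b)\circ c=(-1)^{\beta\gamma}(a\circ c)\circ b$ and $(a\circ b)\circ c-a\circ(b\circ c)=(-1)^{\alpha\beta}[(b\circ a)\circ c-b\circ(a\circ c)]$. A Lie (resp. Novikov) superalgebraic operation on $V$ is one making $V$ a Lie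 (resp. (left) Novikov) superalgebra. A super Gel'fand-Dorfman bialgebra is a $\mathbb{Z}/2\mathbb{Z}$-graded vector space $A=A_{\bar0}\oplus A_{\bar1}$ with two operations $[\cdot,\cdot]$ and $\circ$ such that $(A,[\cdot,\cdot])$ is a Lie superalgebra, $(A,\circ)$ is a (left) Novikov superalgebra, and $[a\circ b,c]+[a,b]\circ c-a\circ[b,c]-(-1)^{\beta\gamma}[a\circ c,b]-(-1)^{\beta\gamma}[a,c]\circ b=0$ for $a\in A$, $b\in A_\beta$, $c\in A_\gamma$. *)

theory Defs
  imports Complex_Main "HOL-Library.Poly_Mapping" "HOL-Library.Z2"
begin

hide_const (open) Poly_Mapping.map Poly_Mapping.range Poly_Mapping.nth

section \<open>Polynomials with coefficients in a module\<close>

text \<open>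
  For a type \<open>'x\<close> of variables, the type \<open>('x, 'm) pol\<close> consists of the polynomials in these
  variables with coefficients in \<open>'m\<close>.  If \<open>'m\<close> is a commutative ring, then so is
  \<open>('x, 'm) pol\<close> (library instances).  The \<open>r\<close> variables of the mathematical text are indexed by a
  type \<open>'r\<close> of class \<open>finite\<close> with \<open>r = CARD('r)\<close>, which is automatically positive.
  So \<open>('r, complex) pol\<close> is \<open>\<complex>[T]\<close>, \<open>('r, 'v) pol\<close> is \<open>\<complex>[T]V\<close>, and for an \<open>R\<close> carried by
  the type \<open>'m\<close>, \<open>('r, 'm) pol\<close> is \<open>R[\<lambda>]\<close> and \<open>('r + 'r, 'm) pol\<close> is \<open>R[\<lambda>,\<mu>]\<close>.
\<close>

type_synonym ('x, 'm) pol = "('x \<Rightarrow>\<^sub>0 nat) \<Rightarrow>\<^sub>0 'm"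

definition const :: "'m::zero \<Rightarrow> ('x, 'm) pol"
  where "const c = Poly_Mapping.single 0 c"

definition var :: "'x \<Rightarrow> ('x, 'c::zero_neq_one) pol"
  where "var i = Poly_Mapping.single (Poly_Mapping.single i 1) 1"

text \<open>
  The action of the polynomial ring over \<open>'c\<close> on polynomials with coefficients in a
  \<open>'c\<close>-module, obtained by extension of scalars from the action \<open>s\<close>.  Both the
  \<open>\<complex>[T]\<close>-module \<open>\<complex>[T]V\<close> and the \<open>\<complex>[T][\<lambda>]\<close>-module \<open>R[\<lambda>]\<close> (for a \<open>\<complex>[T]\<close>-module \<open>R\<close>)
  are instances.
\<close>

definition pol_scale ::
  "('c::comm_ring_1 \<Rightarrow> 'm::ab_group_add \<Rightarrow> 'm) \<Rightarrow> ('x, 'c) pol \<Rightarrow> ('x, 'm) pol \<Rightarrow> ('x, 'm) pol"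
  where "pol_scale s p P =
    (\<Sum>m\<in>Poly_Mapping.keys p. \<Sum>n\<in>Poly_Mapping.keys P.
       Poly_Mapping.single (m + n) (s (Poly_Mapping.lookup p m) (Poly_Mapping.lookup P n)))"

text \<open>
  Substitution: if \<open>P = \<Sum>\<^sub>m \<nu>\<^sup>m z\<^sub>m\<close>, then \<open>subst s x h P = \<Sum>\<^sub>m x\<^sup>m \<cdot> h z\<^sub>m\<close>, where the \<open>x\<^sub>i\<close> are
  elements of a commutative ring acting by \<open>s\<close> on the codomain of \<open>h\<close>.
\<close>

definition subst ::
  "('s::comm_ring_1 \<Rightarrow> 'n::ab_group_add \<Rightarrow> 'n) \<Rightarrow> ('r::finite \<Rightarrow> 's) \<Rightarrow> ('m::zero \<Rightarrow> 'n)
     \<Rightarrow> ('r, 'm) pol \<Rightarrow> 'n"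
  where "subst s x h P =
    (\<Sum>m\<in>Poly_Mapping.keys P.
       s (\<Prod>i\<in>UNIV. x i ^ Poly_Mapping.lookup m i) (h (Poly_Mapping.lookup P m)))"

lemma pol_scale_superset:
  assumes "module s" "finite A" "Poly_Mapping.keys p \<subseteq> A" "finite B" "Poly_Mapping.keys P \<subseteq> B"
  shows "pol_scale s p P = (\<Sum>m\<in>A. \<Sum>n\<in>B.
    Poly_Mapping.single (m + n) (s (Poly_Mapping.lookup p m) (Poly_Mapping.lookup P n)))"
proof -
  interpret module s by fact
  have "(\<Sum>n\<in>Poly_Mapping.keys P.
      Poly_Mapping.single (m + n) (s (Poly_Mapping.lookup p m) (Poly_Mapping.lookup P n)))
    = (\<Sum>n\<in>B. Poly_Mapping.single (m + n) (s (Poly_Mapping.lookup p m) (Poly_Mapping.lookup P n)))"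
    for m
    using assms by (intro sum.mono_neutral_left) (auto simp: in_keys_iff)
  then show ?thesis
    unfolding pol_scale_def
    using assms by (simp, intro sum.mono_neutral_left) (auto simp: in_keys_iff)
qed

lemma pol_scale_add_left:
  assumes "module s"
  shows "pol_scale s (p + q) P = pol_scale s p P + pol_scale s q P"
proof -
  interpret module s by fact
  let ?A = "Poly_Mapping.keys p \<union> Poly_Mapping.keys q" and ?B = "Poly_Mapping.keys P"
  have "Poly_Mapping.keys (p + q) \<subseteq> ?A" by (rule keys_add)
  then show ?thesis
    using assms
    by (simp add: pol_scale_superset[where A = ?A and B = ?B] lookup_add scale_left_distrib
        single_add sum.distrib)
qed

lemma pol_scale_add_right:
  assumes "module s"
  shows "pol_scale s p (P + Q) = pol_scale s p P + pol_scale s p Q"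
proof -
  interpret module s by fact
  let ?A = "Poly_Mapping.keys p" and ?B = "Poly_Mapping.keys P \<union> Poly_Mapping.keys Q"
  have "Poly_Mapping.keys (P + Q) \<subseteq> ?B" by (rule keys_add)
  then show ?thesis
    using assms
    by (simp add: pol_scale_superset[where A = ?A and B = ?B] lookup_add scale_right_distrib
        single_add sum.distrib)
qed

lemma pol_scale_single:
  assumes "module s"
  shows "pol_scale s (Poly_Mapping.single m a) (Poly_Mapping.single n x)
    = Poly_Mapping.single (m + n) (s a x)"
proof -
  interpret module s by fact
  show ?thesis
    using assms by (simp add: pol_scale_superset[where A = "{m}" and B = "{n}"])
qed

lemma pol_induct:
  fixes p :: "'k \<Rightarrow>\<^sub>0 'm::ab_group_add"
  assumes "\<And>k c. P (Poly_Mapping.single k c)" "\<And>p q. P p \<Longrightarrow> P q \<Longrightarrow> P (p + q)"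
  shows "P p"
proof -
  have 0: "P 0" using assms(1)[of undefined 0] by simp
  have "P (\<Sum>k\<in>K. Poly_Mapping.single k (Poly_Mapping.lookup p k))" if "finite K" for K
    using that by induction (use 0 assms in auto)
  moreover have "(\<Sum>k\<in>Poly_Mapping.keys p. Poly_Mapping.single k (Poly_Mapping.lookup p k)) = p"
    by (rule poly_mapping_eqI)
      (simp add: lookup_sum lookup_single when_def in_keys_iff)
  ultimately show ?thesis
    by (metis finite_keys)
qed

lemma module_pol_scale:
  fixes s :: "'c::comm_ring_1 \<Rightarrow> 'm::ab_group_add \<Rightarrow> 'm"
  assumes "module s"
  shows "module (pol_scale s :: ('x, 'c) pol \<Rightarrow> ('x, 'm) pol \<Rightarrow> ('x, 'm) pol)"
proof
  interpret module s by fact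
  note add = pol_scale_add_left[OF assms] pol_scale_add_right[OF assms]
  fix p q :: "('x, 'c) pol" and P Q :: "('x, 'm) pol"
  show "pol_scale s p (P + Q) = pol_scale s p P + pol_scale s p Q"
    "pol_scale s (p + q) P = pol_scale s p P + pol_scale s q P"
    by (fact add)+
  show "pol_scale s p (pol_scale s q P) = pol_scale s (p * q) P"
  proof (induction p rule: pol_induct)
    case (1 k c)
    show ?case
    proof (induction q rule: pol_induct)
      case (1 l d)
      show ?case
      proof (induction P rule: pol_induct)
        case (1 n x)
        show ?case
          by (simp add: pol_scale_single assms mult_single add.assoc)
      qed (simp add: add)
    qed (simp add: add distrib_left)
  qed (simp add: add distrib_right)
  show "pol_scale s 1 P = P"
  proof (induction P rule: pol_induct)
    case (1 n x)
    show ?case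
      using pol_scale_single[OF assms, of 0 1 n x] by simp
  qed (simp add: add)
qed


section \<open>Gradings\<close>

text \<open>
  \<open>sgnpow \<epsilon> x\<close> is \<open>(-1)\<^sup>\<epsilon> x\<close>.  The type \<open>bit\<close> is the field \<open>\<int>/2\<int>\<close>.
  Over a field, the locale \<open>module\<close> is the same as \<open>vector_space\<close>; it is used for both the
  graded vector space \<open>V\<close> and the graded \<open>\<complex>[T]\<close>-module \<open>R\<close>, whose homogeneous parts are
  then \<open>\<complex>[T]\<close>-submodules.
\<close>

definition sgnpow :: "bit \<Rightarrow> 'm::ab_group_add \<Rightarrow> 'm"
  where "sgnpow e x = (if e = 1 then - x else x)"

locale graded_module = module scale
  for scale :: "'c::comm_ring_1 \<Rightarrow> 'm::ab_group_add \<Rightarrow> 'm" +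
  fixes G :: "bit \<Rightarrow> 'm set"
  assumes subspace_grade: "\<And>\<alpha>. subspace (G \<alpha>)"
    and grade_disjoint: "G 0 \<inter> G 1 = {0}"
    and grade_sum: "\<And>x. \<exists>x0\<in>G 0. \<exists>x1\<in>G 1. x = x0 + x1"

locale graded_algebra = graded_module scale G
  for scale :: "complex \<Rightarrow> 'v::ab_group_add \<Rightarrow> 'v" and G +
  fixes mult :: "'v \<Rightarrow> 'v \<Rightarrow> 'v"
  assumes linear_right: "\<And>a. module_hom scale scale (mult a)"
    and linear_left: "\<And>b. module_hom scale scale (\<lambda>a. mult a b)"
    and mult_grade: "\<And>\<alpha> \<beta> a b. a \<in> G \<alpha> \<Longrightarrow> b \<in> G \<beta> \<Longrightarrow> mult a b \<in> G (\<alpha> + \<beta>)"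


section \<open>Lie, Novikov and Gel'fand-Dorfman superalgebras\<close>

locale lie_superalgebra = graded_algebra scale G lie
  for scale :: "complex \<Rightarrow> 'v::ab_group_add \<Rightarrow> 'v" and G and lie +
  assumes skew: "\<And>\<alpha> \<beta> a b. a \<in> G \<alpha> \<Longrightarrow> b \<in> G \<beta> \<Longrightarrow>
      lie a b = - sgnpow (\<alpha> * \<beta>) (lie b a)"
    and jacobi: "\<And>\<alpha> \<beta> a b c. a \<in> G \<alpha> \<Longrightarrow> b \<in> G \<beta> \<Longrightarrow>
      lie a (lie b c) = lie (lie a b) c + sgnpow (\<alpha> * \<beta>) (lie b (lie a c))"

locale novikov_superalgebra = graded_algebra scale G nov
  for scale :: "complex \<Rightarrow> 'v::ab_group_add \<Rightarrow> 'v" and G and nov +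
  assumes right_commute: "\<And>\<alpha> \<beta> \<gamma> a b c. a \<in> G \<alpha> \<Longrightarrow> b \<in> G \<beta> \<Longrightarrow> c \<in> G \<gamma> \<Longrightarrow>
      nov (nov a b) c = sgnpow (\<beta> * \<gamma>) (nov (nov a c) b)"
    and left_symmetric: "\<And>\<alpha> \<beta> \<gamma> a b c. a \<in> G \<alpha> \<Longrightarrow> b \<in> G \<beta> \<Longrightarrow> c \<in> G \<gamma> \<Longrightarrow>
      nov (nov a b) c - nov a (nov b c)
      = sgnpow (\<alpha> * \<beta>) (nov (nov b a) c - nov b (nov a c))"

locale super_gelfand_dorfman_bialgebra =
  lie_superalgebra scale G lie + nov: novikov_superalgebra scale G nov
  for scale :: "complex \<Rightarrow> 'v::ab_group_add \<Rightarrow> 'v" and G and lie and nov +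
  assumes compat: "\<And>\<beta> \<gamma> a b c. b \<in> G \<beta> \<Longrightarrow> c \<in> G \<gamma> \<Longrightarrow>
      lie (nov a b) c + nov (lie a b) c - nov a (lie b c)
      - sgnpow (\<beta> * \<gamma>) (lie (nov a c) b) - sgnpow (\<beta> * \<gamma>) (nov (lie a c) b) = 0"

text \<open>\<open>nov i\<close> is the operation \<open>\<circ>\<^sub>i\<close>.\<close>

locale generalized_super_gelfand_dorfman_algebra =
  fixes scale :: "complex \<Rightarrow> 'v::ab_group_add \<Rightarrow> 'v"
    and G :: "bit \<Rightarrow> 'v set"
    and lie :: "'v \<Rightarrow> 'v \<Rightarrow> 'v"
    and nov :: "'r::finite \<Rightarrow> 'v \<Rightarrow> 'v \<Rightarrow> 'v"
  assumes bialgebra: "\<And>i. super_gelfand_dorfman_bialgebra scale G lie (nov i)"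
    and cross_left_symmetric: "\<And>i j \<alpha> \<beta> a b c. i \<noteq> j \<Longrightarrow> a \<in> G \<alpha> \<Longrightarrow> b \<in> G \<beta> \<Longrightarrow>
      nov i a (nov j b c) - nov j (nov i a b) c
      = sgnpow (\<alpha> * \<beta>) (nov j b (nov i a c) - nov i (nov j b a) c)"
    and cross_right_commute: "\<And>i j \<alpha> \<beta> a b c. i \<noteq> j \<Longrightarrow> a \<in> G \<alpha> \<Longrightarrow> b \<in> G \<beta> \<Longrightarrow>
      nov j (nov i c a) b + nov i (nov j c a) b
      = sgnpow (\<alpha> * \<beta>) (nov j (nov i c b) a + nov i (nov j c b) a)"


section \<open>Lie conformal superalgebras\<close>

text \<open>
  Given a \<open>\<lambda>\<close>-bracket \<open>br\<close> on a \<open>\<complex>[T]\<close>-module with action \<open>act\<close>, \<open>br_at act br x a b\<close> is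
  \<open>[a\<^sub>x b]\<close>, where the \<open>x\<^sub>i\<close> are polynomials over \<open>\<complex>[T]\<close> in some further variables;
  \<open>T\<close> in \<open>x\<close> acts on the coefficients of \<open>[a\<^sub>\<nu> b]\<close>.
\<close>

definition br_at ::
  "(('r::finite, complex) pol \<Rightarrow> 'm::ab_group_add \<Rightarrow> 'm) \<Rightarrow> ('m \<Rightarrow> 'm \<Rightarrow> ('r, 'm) pol)
     \<Rightarrow> ('r \<Rightarrow> ('y, ('r, complex) pol) pol) \<Rightarrow> 'm \<Rightarrow> 'm \<Rightarrow> ('y, 'm) pol"
  where "br_at act br x a b = subst (pol_scale act) x const (br a b)"

text \<open>\<open>[a\<^sub>x [b\<^sub>y c]]\<close> and \<open>[[a\<^sub>x b]\<^sub>y c]\<close>: the brackets are extended linearly to the coefficients of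
  the polynomial given by the inner bracket.\<close>

definition br_br_right ::
  "(('r::finite, complex) pol \<Rightarrow> 'm::ab_group_add \<Rightarrow> 'm) \<Rightarrow> ('m \<Rightarrow> 'm \<Rightarrow> ('r, 'm) pol)
     \<Rightarrow> ('r \<Rightarrow> ('y, ('r, complex) pol) pol) \<Rightarrow> ('r \<Rightarrow> ('y, ('r, complex) pol) pol)
     \<Rightarrow> 'm \<Rightarrow> 'm \<Rightarrow> 'm \<Rightarrow> ('y, 'm) pol"
  where "br_br_right act br x y a b c =
    subst (pol_scale act) y (\<lambda>z. br_at act br x a z) (br b c)"

definition br_br_left ::
  "(('r::finite, complex) pol \<Rightarrow> 'm::ab_group_add \<Rightarrow> 'm) \<Rightarrow> ('m \<Rightarrow> 'm \<Rightarrow> ('r, 'm) pol)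
     \<Rightarrow> ('r \<Rightarrow> ('y, ('r, complex) pol) pol) \<Rightarrow> ('r \<Rightarrow> ('y, ('r, complex) pol) pol)
     \<Rightarrow> 'm \<Rightarrow> 'm \<Rightarrow> 'm \<Rightarrow> ('y, 'm) pol"
  where "br_br_left act br x y a b c =
    subst (pol_scale act) x (\<lambda>z. br_at act br y z c) (br a b)"

text \<open>
  In the axioms below, \<open>var i\<close> of type \<open>('r, complex) pol\<close> is \<open>T\<^sub>i\<close>; in the ring \<open>\<complex>[T][\<lambda>]\<close> acting on
  \<open>R[\<lambda>]\<close>, \<open>var i\<close> is \<open>\<lambda>\<^sub>i\<close> and \<open>const (var i)\<close> is \<open>T\<^sub>i\<close>; in \<open>\<complex>[T][\<lambda>,\<mu>]\<close>, \<open>var (Inl i)\<close> is \<open>\<lambda>\<^sub>i\<close> and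
  \<open>var (Inr i)\<close> is \<open>\<mu>\<^sub>i\<close>.  Scalars from \<open>\<complex>\<close> are embedded by \<open>const\<close>.
\<close>

locale lie_conformal_superalgebra = graded_module act G
  for act :: "('r::finite, complex) pol \<Rightarrow> 'm::ab_group_add \<Rightarrow> 'm" and G +
  fixes br :: "'m \<Rightarrow> 'm \<Rightarrow> ('r, 'm) pol"
  assumes linear_right:
      "\<And>a. module_hom (\<lambda>c. act (const c)) (\<lambda>c. pol_scale act (const (const c))) (br a)"
    and linear_left:
      "\<And>b. module_hom (\<lambda>c. act (const c)) (\<lambda>c. pol_scale act (const (const c))) (\<lambda>a. br a b)"
    and br_grade: "\<And>\<alpha> \<beta> a b m. a \<in> G \<alpha> \<Longrightarrow> b \<in> G \<beta> \<Longrightarrow>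
      Poly_Mapping.lookup (br a b) m \<in> G (\<alpha> + \<beta>)"
    and sesqui_left: "\<And>i a b. br (act (var i) a) b = - pol_scale act (var i) (br a b)"
    and sesqui_right: "\<And>i a b. br a (act (var i) b)
      = pol_scale act (const (var i) + var i) (br a b)"
    and conformal_skew: "\<And>\<alpha> \<beta> a b. a \<in> G \<alpha> \<Longrightarrow> b \<in> G \<beta> \<Longrightarrow>
      br a b = - sgnpow (\<alpha> * \<beta>) (br_at act br (\<lambda>i. - (var i + const (var i))) b a)"
    and conformal_jacobi: "\<And>\<alpha> \<beta> a b c. a \<in> G \<alpha> \<Longrightarrow> b \<in> G \<beta> \<Longrightarrow>
      br_br_right act br (\<lambda>i. var (Inl i)) (\<lambda>i. var (Inr i)) a b c
      = br_br_left act br (\<lambda>i. var (Inl i)) (\<lambda>i. var (Inl i) + var (Inr i)) a b c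
        + sgnpow (\<alpha> * \<beta>) (br_br_right act br (\<lambda>i. var (Inr i)) (\<lambda>i. var (Inl i)) b a c)"

definition pol_grade :: "(bit \<Rightarrow> 'v::zero set) \<Rightarrow> bit \<Rightarrow> ('r, 'v) pol set"
  where "pol_grade V \<alpha> = {P. \<forall>m. Poly_Mapping.lookup P m \<in> V \<alpha>}"

text \<open>
  \<open>linear_form w u v\<close> is \<open>\<Sum>\<^sub>i \<lambda>\<^sub>i w\<^sub>i + \<Sum>\<^sub>j T\<^sub>j u\<^sub>j + v\<close> in \<open>(\<complex>[T]V)[\<lambda>]\<close>: the outer exponent is the one of
  \<open>\<lambda>\<close>, the inner exponent the one of \<open>T\<close>.
\<close>

definition linear_form ::
  "('r::finite \<Rightarrow> 'v::ab_group_add) \<Rightarrow> ('r \<Rightarrow> 'v) \<Rightarrow> 'v \<Rightarrow> ('r, ('r, 'v) pol) pol"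
  where "linear_form w u v =
    (\<Sum>i\<in>UNIV. Poly_Mapping.single (Poly_Mapping.single i 1) (const (w i)))
    + (\<Sum>j\<in>UNIV. const (Poly_Mapping.single (Poly_Mapping.single j 1) (u j)))
    + const (const v)"

locale linear_lie_conformal_superalgebra =
  V: graded_module scale V + lie_conformal_superalgebra "pol_scale scale" "pol_grade V" br
  for scale :: "complex \<Rightarrow> 'v::ab_group_add \<Rightarrow> 'v" and V
    and br :: "('r::finite, 'v) pol \<Rightarrow> ('r, 'v) pol \<Rightarrow> ('r, ('r, 'v) pol) pol" +
  assumes br_linear: "\<And>a b. \<exists>w u v. br (const a) (const b) = linear_form w u v"

text \<open>
  The correspondence between \<open>\<lambda>\<close>-brackets on \<open>\<complex>[T]V\<close> and operations on \<open>V\<close>: for homogeneous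
  \<open>a\<close>, \<open>b\<close> of degrees \<open>\<alpha>\<close>, \<open>\<beta>\<close>,
  \<open>[a\<^sub>\<lambda> b] = \<Sum>\<^sub>i \<lambda>\<^sub>i (a \<circ>\<^sub>i b + (-1)\<^sup>\<alpha>\<^sup>\<beta> b \<circ>\<^sub>i a) + \<Sum>\<^sub>j T\<^sub>j (-1)\<^sup>\<alpha>\<^sup>\<beta> b \<circ>\<^sub>j a + [a,b]\<close>.
  That the coefficients of \<open>\<lambda>\<^sub>i\<close> are determined by those of \<open>T\<^sub>i\<close> is forced by skew-symmetry.
\<close>

definition corresponds ::
  "(bit \<Rightarrow> 'v::ab_group_add set) \<Rightarrow> (('r::finite, 'v) pol \<Rightarrow> ('r, 'v) pol \<Rightarrow> ('r, ('r, 'v) pol) pol)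
     \<Rightarrow> ('v \<Rightarrow> 'v \<Rightarrow> 'v) \<Rightarrow> ('r \<Rightarrow> 'v \<Rightarrow> 'v \<Rightarrow> 'v) \<Rightarrow> bool"
  where "corresponds V br lie nov \<longleftrightarrow>
    (\<forall>\<alpha> \<beta>. \<forall>a\<in>V \<alpha>. \<forall>b\<in>V \<beta>. br (const a) (const b) =
       linear_form (\<lambda>i. nov i a b + sgnpow (\<alpha> * \<beta>) (nov i b a))
         (\<lambda>j. sgnpow (\<alpha> * \<beta>) (nov j b a)) (lie a b))"

end

theory Submission
  imports Defs
begin

text \<open>
  Write \<open>R = \<complex>[T]V\<close>.  A sesquilinear bracket on \<open>R\<close> is determined by its values on \<open>V\<close>, and a
  bracket that is linear on \<open>V\<close> is given by three families of bilinear products on \<open>V\<close>: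
  \[
    [a_\lambda b] = \sum_i \lambda_i\, w_i(a,b) + \sum_i T_i\, u_i(a,b) + v(a,b) .
  \]
  Comparing coefficients turns the axioms of the bracket into identities for \<open>w\<close>, \<open>u\<close> and \<open>v\<close>.

  Skew-symmetry on \<open>V\<close> says that \<open>v\<close> is skew and that \<open>w\<close> is determined by \<open>u\<close>: if
  \<open>a \<circ>\<^sub>i b = (-1)\<^sup>\<alpha>\<^sup>\<beta> u\<^sub>i(b,a)\<close> denotes the super-opposite product of \<open>u\<^sub>i\<close>, then
  \<open>w\<^sub>i(a,b) = a \<circ>\<^sub>i b + (-1)\<^sup>\<alpha>\<^sup>\<beta> b \<circ>\<^sub>i a\<close>.  Hence the bracket amounts to the products \<open>\<circ>\<^sub>i\<close> and
  \<open>[a,b] = v(a,b)\<close>, as in \<^const>\<open>corresponds\<close>.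

  Both sides of the Jacobi identity on \<open>V\<close> are polynomials of degree at most two in \<open>\<lambda>\<close>, \<open>\<mu>\<close> and \<open>T\<close>
  (lemmas \<open>br_br_right_generators\<close> and \<open>br_br_left_generators\<close>).  The coefficient of \<open>T\<^sub>iT\<^sub>j\<close>, which is
  symmetric in \<open>i\<close> and \<open>j\<close>, is right commutativity; modulo it the coefficient of \<open>\<lambda>\<^sub>iT\<^sub>j\<close> is left
  symmetry of the pair \<open>\<circ>\<^sub>i\<close>, \<open>\<circ>\<^sub>j\<close>; the coefficient of \<open>T\<^sub>i\<close> is the compatibility of \<open>\<circ>\<^sub>i\<close> with the Lie
  operation; and the constant coefficient is the Jacobi identity on \<open>V\<close>.  So a linear Lie conformal
  superalgebra gives a generalized super Gel'fand-Dorfman algebra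
  (\<open>generalized_gelfand_dorfman\<close>).

  Conversely, these four families of identities and skew-symmetry of the Lie operation imply those of the remaining coefficients (the lemmas
  \<open>coefficient_XX\<close> to \<open>coefficient_T\<close>), so the bracket defined on \<open>V\<close> by the operations satisfies
  skew-symmetry and the Jacobi identity on \<open>V\<close>.  It has a unique sesquilinear extension to \<open>R\<close>.
  Replacing one argument \<open>x\<close> by \<open>T\<^sub>i x\<close> multiplies all terms of an axiom by the same element of
  \<open>\<complex>[T][\<lambda>,\<mu>]\<close>, and \<open>R\<close> is generated by \<open>V\<close> under the \<open>T\<^sub>i\<close> and addition, so the axioms carry over
  from \<open>V\<close> to \<open>R\<close> (\<open>skew_from_generators\<close> and \<open>jacobi_from_generators\<close>).

  Uniqueness is clear on homogeneous elements, since a linear form determines its coefficients, and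
  follows in general by additivity.
\<close>

section \<open>Substitution and coefficients\<close>

lemma subst_superset:
  assumes "module s" "additive h" "finite A" "Poly_Mapping.keys P \<subseteq> A"
  shows "subst s x h P =
    (\<Sum>m\<in>A. s (\<Prod>i\<in>UNIV. x i ^ Poly_Mapping.lookup m i) (h (Poly_Mapping.lookup P m)))"
proof -
  interpret module s by fact
  interpret h: additive h by fact
  show ?thesis
    unfolding subst_def
    using assms by (intro sum.mono_neutral_left) (auto simp: in_keys_iff h.zero)
qed

lemma subst_single:
  assumes "module s" "additive h"
  shows "subst s x h (Poly_Mapping.single m c) = s (\<Prod>i\<in>UNIV. x i ^ Poly_Mapping.lookup m i) (h c)"
  using subst_superset[OF assms, of "{m}" "Poly_Mapping.single m c"] by simp

lemma additive_subst:
  fixes s :: "'s::comm_ring_1 \<Rightarrow> 'n::ab_group_add \<Rightarrow> 'n" and x :: "'r::finite \<Rightarrow> 's"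
    and h :: "'m::ab_group_add \<Rightarrow> 'n"
  assumes "module s" "additive h"
  shows "additive (subst s x h)"
proof
  interpret module s by fact
  interpret h: additive h by fact
  fix P Q :: "('r, 'm) pol"
  let ?A = "Poly_Mapping.keys P \<union> Poly_Mapping.keys Q"
  have "Poly_Mapping.keys (P + Q) \<subseteq> ?A" by (rule keys_add)
  then show "subst s x h (P + Q) = subst s x h P + subst s x h Q"
    using assms
    by (simp add: subst_superset[where A = ?A] lookup_add scale_right_distrib h.add sum.distrib)
qed

lemma subst_const:
  assumes "module s" "additive h"
  shows "subst s x h (const c) = h c"
proof -
  interpret module s by fact
  show ?thesis using assms by (simp add: const_def subst_single)
qed

lemma additive_const: "additive (const :: 'm::ab_group_add \<Rightarrow> ('x, 'm) pol)"
  by standard (simp add: const_def single_add)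

lemma additive_scale: "module s \<Longrightarrow> additive (s p)"
  by (simp add: additive_def module.scale_right_distrib)

lemma pol_scale_var_single:
  assumes "module act"
  shows "pol_scale act (var i) (Poly_Mapping.single m c)
    = Poly_Mapping.single (Poly_Mapping.single i 1 + m) c"
  using pol_scale_single[OF assms, of "Poly_Mapping.single i 1" 1 m c]
  by (simp add: var_def module.scale_one[OF assms])

lemma pol_scale_const_single:
  assumes "module act"
  shows "pol_scale act (const t) (Poly_Mapping.single m c) = Poly_Mapping.single m (act t c)"
  using pol_scale_single[OF assms, of 0 t m c] by (simp add: const_def)

lemma pol_scale_const_const:
  assumes "module act"
  shows "pol_scale act (const t) (const c) = const (act t c)"
  by (simp add: const_def pol_scale_single[OF assms])

lemma monomial_shift:
  fixes x :: "'r::finite \<Rightarrow> 's::comm_ring_1"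
  shows "(\<Prod>j\<in>UNIV. x j ^ Poly_Mapping.lookup (Poly_Mapping.single i 1 + m) j)
    = x i * (\<Prod>j\<in>UNIV. x j ^ Poly_Mapping.lookup m j)"
proof -
  have "(\<Prod>j\<in>UNIV. x j ^ Poly_Mapping.lookup (Poly_Mapping.single i 1) j) = (\<Prod>j\<in>UNIV. if i = j then x j else 1)"
    by (rule prod.cong) (auto simp: lookup_single when_def)
  then show ?thesis
    by (simp add: lookup_add power_add prod.distrib)
qed

text \<open>
  With the next lemma this says that substitution is semilinear: the variables act through the values
  substituted for them, while coefficients act before \<open>h\<close> is applied.
\<close>

lemma subst_scale_var:
  assumes "module s" "additive h" "module act"
  shows "subst s x h (pol_scale act (var i) P) = s (x i) (subst s x h P)"
proof -
  interpret s: module s by fact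
  interpret h: additive h by fact
  interpret sub: additive "subst s x h" using assms(1,2) by (rule additive_subst)
  show ?thesis
  proof (induction P rule: pol_induct)
    case (1 k c)
    show ?case
      using assms
      by (simp add: pol_scale_var_single subst_single monomial_shift del: One_nat_def)
  qed (simp add: pol_scale_add_right[OF assms(3)] sub.add s.scale_right_distrib)
qed

lemma subst_scale_const:
  assumes "module s" "additive h" "module act"
  shows "subst s x h (pol_scale act (const t) P) = subst s x (\<lambda>z. h (act t z)) P"
proof -
  interpret s: module s by fact
  interpret h: additive h by fact
  interpret act: module act by fact
  have g: "additive (\<lambda>z. h (act t z))"
    by standard (simp add: act.scale_right_distrib h.add)
  interpret sub: additive "subst s x h" using assms(1,2) by (rule additive_subst)
  interpret sub': additive "subst s x (\<lambda>z. h (act t z))" using assms(1) g by (rule additive_subst)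
  show ?thesis
  proof (induction P rule: pol_induct)
    case (1 k c)
    show ?case
      using assms g by (simp add: pol_scale_const_single subst_single)
  qed (simp add: pol_scale_add_right[OF assms(3)] sub.add sub'.add s.scale_right_distrib)
qed

lemma subst_map_add:
  assumes "module s"
  shows "subst s x (\<lambda>z. h z + g z) P = subst s x h P + subst s x g P"
proof -
  interpret s: module s by fact
  show ?thesis by (simp add: subst_def s.scale_right_distrib sum.distrib)
qed

lemma subst_map_scale:
  assumes "module s"
  shows "subst s x (\<lambda>z. s p (h z)) P = s p (subst s x h P)"
proof -
  interpret s: module s by fact
  show ?thesis by (simp add: subst_def s.scale_sum_right mult.commute)
qed

lemma lookup_scale_const:
  assumes "module act"
  shows "Poly_Mapping.lookup (pol_scale act (const t) P) m = act t (Poly_Mapping.lookup P m)"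
proof -
  interpret act: module act by fact
  show ?thesis
  proof (induction P rule: pol_induct)
    case (1 k c)
    show ?case
      using assms by (simp add: pol_scale_const_single lookup_single when_def)
  qed (simp add: pol_scale_add_right[OF assms] lookup_add act.scale_right_distrib)
qed

lemma lookup_scale_var:
  assumes "module act"
  shows "Poly_Mapping.lookup (pol_scale act (var i) P) (Poly_Mapping.single i 1 + m)
    = Poly_Mapping.lookup P m"
    "Poly_Mapping.lookup m' i = 0 \<Longrightarrow> Poly_Mapping.lookup (pol_scale act (var i) P) m' = 0"
proof -
  interpret act: module act by fact
  show "Poly_Mapping.lookup (pol_scale act (var i) P) (Poly_Mapping.single i 1 + m)
    = Poly_Mapping.lookup P m"
  proof (induction P rule: pol_induct)
    case (1 k c)
    show ?case
      using assms by (simp add: pol_scale_var_single lookup_single when_def)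
  qed (simp add: pol_scale_add_right[OF assms] lookup_add)
  assume m': "Poly_Mapping.lookup m' i = 0"
  show "Poly_Mapping.lookup (pol_scale act (var i) P) m' = 0"
  proof (induction P rule: pol_induct)
    case (1 k c)
    have "Poly_Mapping.single i 1 + k \<noteq> m'"
      using m' by (auto simp: lookup_add)
    then show ?case
      using assms by (simp add: pol_scale_var_single lookup_single when_def)
  qed (simp add: pol_scale_add_right[OF assms] lookup_add)
qed

text \<open>
  The module \<open>\<complex>[T]V\<close> is generated by \<open>V\<close> under addition and multiplication by the variables.  Tracking a
  set \<open>U\<close> of admissible coefficients lets the induction stay among polynomials of a fixed degree
  in the grading.
\<close>

lemma polynomial_vector_induct [consumes 3, case_names vector times add]:
  fixes scale :: "'c::comm_ring_1 \<Rightarrow> 'v::ab_group_add \<Rightarrow> 'v" and P :: "('r, 'v) pol"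
  assumes "module scale" and zero: "0 \<in> U" and "\<And>m. Poly_Mapping.lookup P m \<in> U"
    and vec: "\<And>v. v \<in> U \<Longrightarrow> Q (const v)"
    and times: "\<And>i P. Q P \<Longrightarrow> Q (pol_scale scale (var i) P)"
    and add: "\<And>P P'. Q P \<Longrightarrow> Q P' \<Longrightarrow> Q (P + P')"
  shows "Q P"
proof -
  have single: "Q (Poly_Mapping.single m v)" if v: "v \<in> U" for m v
  proof -
    have "Q (Poly_Mapping.single m v)" if "degsum = (\<Sum>i\<in>Poly_Mapping.keys m. Poly_Mapping.lookup m i)" for degsum
      using that
    proof (induction degsum arbitrary: m)
      case 0
      then have "m = 0"
        by (intro poly_mapping_eqI) (metis finite_keys in_keys_iff lookup_zero sum_eq_0_iff)
      then show ?case using vec[OF v] by (simp add: const_def)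
    next
      case (Suc d)
      then obtain i where i: "i \<in> Poly_Mapping.keys m"
        by (metis Zero_not_Suc ex_in_conv sum.empty)
      define n where "n = m - Poly_Mapping.single i 1"
      have m: "m = Poly_Mapping.single i 1 + n"
        using i by (intro poly_mapping_eqI)
          (auto simp: n_def lookup_add lookup_minus lookup_single when_def in_keys_iff)
      have ki: "Poly_Mapping.keys m = insert i (Poly_Mapping.keys n)"
        by (auto simp: m in_keys_iff lookup_add lookup_single when_def split: if_splits)
      have "(\<Sum>j\<in>Poly_Mapping.keys m. Poly_Mapping.lookup m j) = Suc (\<Sum>j\<in>Poly_Mapping.keys m. Poly_Mapping.lookup n j)"
        using i by (simp add: m lookup_add lookup_single when_def sum.distrib del: One_nat_def)
      also have "(\<Sum>j\<in>Poly_Mapping.keys m. Poly_Mapping.lookup n j) = (\<Sum>j\<in>Poly_Mapping.keys n. Poly_Mapping.lookup n j)"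
        by (rule sum.mono_neutral_right) (auto simp: ki in_keys_iff)
      finally have "Q (Poly_Mapping.single n v)"
        using Suc by simp
      then show ?case
        using times[of "Poly_Mapping.single n v" i]
        unfolding m pol_scale_var_single[OF assms(1)] by blast
    qed
    then show ?thesis by blast
  qed
  have "Q (\<Sum>k\<in>K. Poly_Mapping.single k (Poly_Mapping.lookup P k))" if "finite K" for K
    using that
  proof induction
    case empty
    show ?case using vec[OF zero] by (simp add: const_def)
  next
    case (insert k K)
    then show ?case using add single assms(3) by simp
  qed
  moreover have "(\<Sum>k\<in>Poly_Mapping.keys P. Poly_Mapping.single k (Poly_Mapping.lookup P k)) = P"
    by (rule poly_mapping_eqI) (simp add: lookup_sum lookup_single when_def in_keys_iff)
  ultimately show ?thesis by (metis finite_keys)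
qed

section \<open>Gradings and super-opposite products\<close>

lemma graded_module_pol:
  fixes s :: "'c::comm_ring_1 \<Rightarrow> 'm::ab_group_add \<Rightarrow> 'm"
  assumes "graded_module s G"
  shows "graded_module (pol_scale s :: ('x, 'c) pol \<Rightarrow> ('x, 'm) pol \<Rightarrow> ('x, 'm) pol) (pol_grade G)"
proof -
  interpret graded_module s G by fact
  note subspaces = subspace_grade[THEN subspace_0] subspace_grade[THEN subspace_add]
    subspace_grade[THEN subspace_scale] subspace_grade[THEN subspace_sum]
  interpret p: module "pol_scale s :: ('x, 'c) pol \<Rightarrow> ('x, 'm) pol \<Rightarrow> ('x, 'm) pol"
    by (rule module_pol_scale) (rule module_axioms)
  show ?thesis
  proof
    show "p.subspace (pol_grade G \<alpha>)" for \<alpha>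
      unfolding p.subspace_def
    proof (intro conjI ballI allI)
      fix p P assume P: "P \<in> (pol_grade G \<alpha> :: ('x, 'm) pol set)"
      show "pol_scale s p P \<in> pol_grade G \<alpha>"
        unfolding pol_scale_def pol_grade_def
        using P by (auto simp: pol_grade_def lookup_sum lookup_single when_def
            intro!: subspaces)
    qed (auto simp: pol_grade_def lookup_add intro: subspaces)
    show "pol_grade G 0 \<inter> pol_grade G 1 = {0 :: ('x, 'm) pol}"
    proof -
      have "P = 0" if "P \<in> pol_grade G 0" "P \<in> pol_grade G 1" for P :: "('x, 'm) pol"
        using that grade_disjoint by (intro poly_mapping_eqI) (auto simp: pol_grade_def)
      then show ?thesis by (auto simp: pol_grade_def subspaces)
    qed
    show "\<exists>P0\<in>pol_grade G 0. \<exists>P1\<in>pol_grade G 1. P = P0 + P1" for P :: "('x, 'm) pol"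
    proof (induction P rule: pol_induct)
      case (1 k c)
      obtain c0 c1 where "c0 \<in> G 0" "c1 \<in> G 1" "c = c0 + c1" using grade_sum by blast
      then show ?case
        by (intro bexI[of _ "Poly_Mapping.single k c0"] bexI[of _ "Poly_Mapping.single k c1"])
          (auto simp: single_add pol_grade_def lookup_single when_def intro: subspaces)
    next
      case (2 p q)
      then obtain p0 p1 q0 q1 where *: "p0 \<in> pol_grade G 0" "p1 \<in> pol_grade G 1" "p = p0 + p1"
        "q0 \<in> pol_grade G 0" "q1 \<in> pol_grade G 1" "q = q0 + q1" by blast
      then show ?case
        by (intro bexI[of _ "p0 + q0"] bexI[of _ "p1 + q1"])
          (auto simp: pol_grade_def lookup_add intro: subspaces)
    qed
  qed
qed

lemma pol_grade_const:
  assumes "0 \<in> G \<alpha>" "v \<in> G \<alpha>"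
  shows "const v \<in> pol_grade G \<alpha>"
  using assms by (simp add: pol_grade_def const_def lookup_single when_def)

lemma additive_sgnpow: "additive (sgnpow e)"
  by standard (simp add: sgnpow_def)

lemmas sgnpow_simps [simp] =
  additive.add[OF additive_sgnpow] additive.zero[OF additive_sgnpow]
  additive.minus[OF additive_sgnpow] additive.diff[OF additive_sgnpow]

lemma sgnpow_bit [simp]: "sgnpow 0 x = x" "sgnpow 1 x = - x"
  by (simp_all add: sgnpow_def)

lemma additive_map_sgnpow: "additive f \<Longrightarrow> f (sgnpow e x) = sgnpow e (f x)"
  by (simp add: sgnpow_def additive.minus)

lemma bit_cases: "(\<alpha>::bit) = 0 \<or> \<alpha> = 1"
  by (cases \<alpha>) auto

lemma bit_1_plus_1: "(1::bit) + 1 = 0"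
  by (simp add: one_add_one)

lemma (in graded_module) grade_0: "0 \<in> G \<alpha>"
  by (rule subspace_0[OF subspace_grade])

lemma (in graded_module) grade_sgnpow: "x \<in> G \<alpha> \<Longrightarrow> sgnpow e x \<in> G \<alpha>"
  by (simp add: sgnpow_def subspace_neg[OF subspace_grade])

text \<open>
  Several axioms have an argument that need not be homogeneous; being additive in it, they need only
  be checked on homogeneous elements.
\<close>

lemma (in graded_module) additive_ext:
  assumes "additive f" "additive g" "\<And>\<alpha> x. x \<in> G \<alpha> \<Longrightarrow> f x = g x"
  shows "f x = g x"
proof -
  obtain x0 x1 where "x0 \<in> G 0" "x1 \<in> G 1" "x = x0 + x1" using grade_sum by blast
  then show ?thesis using assms by (metis additive.add)
qed

lemma (in graded_module) biadditive_ext: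
  assumes "\<And>b. additive (\<lambda>a. f a b)" "\<And>a. additive (f a)"
    "\<And>b. additive (\<lambda>a. g a b)" "\<And>a. additive (g a)"
    "\<And>\<alpha> \<beta> a b. a \<in> G \<alpha> \<Longrightarrow> b \<in> G \<beta> \<Longrightarrow> f a b = g a b"
  shows "f a b = g a b"
proof -
  have "f a b = g a b" if "a \<in> G \<alpha>" for \<alpha> a
    using additive_ext[OF assms(2)[of a] assms(4)[of a]] assms(5) that by blast
  then show ?thesis
    using additive_ext[OF assms(1)[of b] assms(3)[of b]] by blast
qed

text \<open>The projection onto \<open>G \<alpha>\<close> along the other homogeneous part.\<close>

definition part :: "(bit \<Rightarrow> 'm::ab_group_add set) \<Rightarrow> bit \<Rightarrow> 'm \<Rightarrow> 'm"
  where "part G \<alpha> x = (THE y. y \<in> G \<alpha> \<and> x - y \<in> G (\<alpha> + 1))"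

context graded_module
begin

lemma part_unique:
  assumes "y \<in> G \<alpha>" "x - y \<in> G (\<alpha> + 1)"
  shows "part G \<alpha> x = y"
  unfolding part_def
proof (rule the_equality)
  show "y \<in> G \<alpha> \<and> x - y \<in> G (\<alpha> + 1)" using assms by simp
next
  fix z assume z: "z \<in> G \<alpha> \<and> x - z \<in> G (\<alpha> + 1)"
  have "z - y \<in> G \<alpha>" using z assms subspace_diff[OF subspace_grade] by blast
  moreover have "(x - y) - (x - z) \<in> G (\<alpha> + 1)"
    using z assms subspace_diff[OF subspace_grade] by blast
  ultimately have "z - y \<in> G 0 \<inter> G 1"
    using bit_cases[of \<alpha>] by (auto simp: bit_1_plus_1)
  then show "z = y" using grade_disjoint by simp
qed

lemma part_in_grade: "part G \<alpha> x \<in> G \<alpha>" "x - part G \<alpha> x \<in> G (\<alpha> + 1)"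
proof -
  obtain x0 x1 where x: "x0 \<in> G 0" "x1 \<in> G 1" "x = x0 + x1" using grade_sum by blast
  have "\<exists>y. y \<in> G \<alpha> \<and> x - y \<in> G (\<alpha> + 1)"
    using bit_cases[of \<alpha>] x by (elim disjE) (auto intro: exI[of _ x0] exI[of _ x1] simp: bit_1_plus_1)
  then show "part G \<alpha> x \<in> G \<alpha>" "x - part G \<alpha> x \<in> G (\<alpha> + 1)"
    using part_unique by blast+
qed

lemma part_homogeneous: "x \<in> G \<alpha> \<Longrightarrow> part G \<beta> x = (if \<beta> = \<alpha> then x else 0)"
proof (rule part_unique)
  assume "x \<in> G \<alpha>"
  moreover have "\<beta> \<noteq> \<alpha> \<Longrightarrow> \<beta> + 1 = \<alpha>"
    using bit_cases[of \<alpha>] bit_cases[of \<beta>] by (auto simp: bit_1_plus_1)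
  ultimately show "x - (if \<beta> = \<alpha> then x else 0) \<in> G (\<beta> + 1)"
    by (auto simp: grade_0)
qed (simp add: grade_0)

lemma module_hom_part: "module_hom scale scale (part G \<alpha>)"
proof (unfold module_hom_iff, intro conjI allI module_axioms)
  show "part G \<alpha> (x + y) = part G \<alpha> x + part G \<alpha> y" for x y
  proof (rule part_unique)
    have "(x - part G \<alpha> x) + (y - part G \<alpha> y) \<in> G (\<alpha> + 1)"
      by (intro subspace_add[OF subspace_grade] part_in_grade)
    then show "x + y - (part G \<alpha> x + part G \<alpha> y) \<in> G (\<alpha> + 1)"
      by (simp add: algebra_simps)
  qed (intro subspace_add[OF subspace_grade] part_in_grade)
  show "part G \<alpha> (scale c x) = scale c (part G \<alpha> x)" for c x
  proof (rule part_unique)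
    have "scale c (x - part G \<alpha> x) \<in> G (\<alpha> + 1)"
      by (intro subspace_scale[OF subspace_grade] part_in_grade)
    then show "scale c x - scale c (part G \<alpha> x) \<in> G (\<alpha> + 1)"
      by (simp add: scale_right_diff_distrib)
  qed (intro subspace_scale[OF subspace_grade] part_in_grade)
qed

end

text \<open>
  The bilinear extension of \<open>(-1)\<^sup>\<alpha>\<^sup>\<beta> m(b,a)\<close> from homogeneous to arbitrary \<open>a\<close> and \<open>b\<close>; only the pair of
  odd parts contributes a minus sign.
\<close>

definition super_opposite ::
  "(bit \<Rightarrow> 'm::ab_group_add set) \<Rightarrow> ('m \<Rightarrow> 'm \<Rightarrow> 'm) \<Rightarrow> 'm \<Rightarrow> 'm \<Rightarrow> 'm"
  where "super_opposite G m a b =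
    m b (part G 0 a) + m (part G 0 b) (part G 1 a) - m (part G 1 b) (part G 1 a)"

lemma module_hom_additive: "module_hom s t f \<Longrightarrow> additive f"
  by (simp add: additive_def module_hom_iff)

lemma (in graded_algebra) super_opposite_homogeneous:
  assumes "a \<in> G \<alpha>" "b \<in> G \<beta>"
  shows "super_opposite G mult a b = sgnpow (\<alpha> * \<beta>) (mult b a)"
proof -
  interpret l: module_hom scale scale "\<lambda>x. mult x y" for y by (rule linear_left)
  interpret r: module_hom scale scale "mult x" for x by (rule linear_right)
  show ?thesis
    using assms bit_cases[of \<alpha>] bit_cases[of \<beta>]
    by (auto simp: super_opposite_def part_homogeneous[OF assms(1)] part_homogeneous[OF assms(2)]
        l.zero r.zero)
qed

lemma (in graded_algebra) graded_algebra_super_opposite: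
  "graded_algebra scale G (super_opposite G mult)"
proof
  interpret l: module_hom scale scale "\<lambda>x. mult x y" for y by (rule linear_left)
  interpret r: module_hom scale scale "mult x" for x by (rule linear_right)
  interpret p: module_hom scale scale "part G \<alpha>" for \<alpha> by (rule module_hom_part)
  show "super_opposite G mult a (x + y) = super_opposite G mult a x + super_opposite G mult a y"
    "super_opposite G mult (x + y) a = super_opposite G mult x a + super_opposite G mult y a"
    "super_opposite G mult a (scale c x) = scale c (super_opposite G mult a x)"
    "super_opposite G mult (scale c x) a = scale c (super_opposite G mult x a)" for a x y c
    by (simp_all add: super_opposite_def l.add r.add l.scale r.scale p.add p.scale
        scale_right_distrib scale_right_diff_distrib)
  show "super_opposite G mult a b \<in> G (\<alpha> + \<beta>)" if "a \<in> G \<alpha>" "b \<in> G \<beta>" for a b \<alpha> \<beta>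
    using grade_sgnpow[OF mult_grade[OF that(2,1)]] super_opposite_homogeneous[OF that]
    by (metis add.commute)
qed

section \<open>Sesquilinear brackets\<close>

lemma module_sgnpow_scale: "module s \<Longrightarrow> s p (sgnpow e z) = sgnpow e (s p z)"
  by (rule additive_map_sgnpow[OF additive_scale])

text \<open>
  The part of the axioms that makes a bracket a function of its values on module generators.  It is
  separated from the Lie axioms because these are to be proved, for a bracket constructed by
  extension, from their validity on generators.
\<close>

locale sesquilinear_bracket = module act
  for act :: "('r::finite, complex) pol \<Rightarrow> 'm::ab_group_add \<Rightarrow> 'm" +
  fixes br :: "'m \<Rightarrow> 'm \<Rightarrow> ('r, 'm) pol"
  assumes additive_right: "additive (br a)"
    and additive_left: "additive (\<lambda>a. br a b)"
    and sesqui_left: "br (act (var i) a) b = - pol_scale act (var i) (br a b)"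
    and sesqui_right: "br a (act (var i) b) = pol_scale act (const (var i) + var i) (br a b)"
begin

lemma module_pol: "module (pol_scale act)"
  by (rule module_pol_scale[OF module_axioms])

sublocale pol: module "pol_scale act :: ('y, ('r, complex) pol) pol \<Rightarrow> ('y, 'm) pol \<Rightarrow> ('y, 'm) pol"
  by (rule module_pol)

lemma additive_br_at:
  "additive (br_at act br x a)" "additive (\<lambda>a. br_at act br x a b)"
  using additive_subst[OF module_pol additive_const, of x]
  by (simp_all add: br_at_def additive_def additive.add[OF additive_left]
      additive.add[OF additive_right])

lemma br_at_T_left:
  "br_at act br x (act (var i) a) b = - pol_scale act (x i) (br_at act br x a b)"
  by (simp add: br_at_def sesqui_left subst_scale_var[OF module_pol additive_const module_axioms]
      additive.minus[OF additive_subst[OF module_pol additive_const]])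

lemma br_at_T_right:
  "br_at act br x a (act (var i) b) = pol_scale act (const (var i) + x i) (br_at act br x a b)"
proof -
  have "subst (pol_scale act) x (\<lambda>z. const (act (var i) z)) P
      = pol_scale act (const (var i)) (subst (pol_scale act) x const P)" for P
    by (simp add: subst_map_scale[OF module_pol] flip: pol_scale_const_const[OF module_axioms])
  then show ?thesis
    by (simp add: br_at_def sesqui_right pol.scale_left_distrib
      additive.add[OF additive_subst[OF module_pol additive_const]]
      subst_scale_var[OF module_pol additive_const module_axioms]
      subst_scale_const[OF module_pol additive_const module_axioms])
qed

lemma br_at_add_left:
  "br_at act br x (a + a') = (\<lambda>z. br_at act br x a z + br_at act br x a' z)"
  by (simp add: fun_eq_iff additive.add[OF additive_br_at(2)])

lemma additive_br_br_right:
  "additive (\<lambda>a. br_br_right act br x y a b c)"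
  "additive (\<lambda>b. br_br_right act br x y a b c)"
  "additive (\<lambda>c. br_br_right act br x y a b c)"
  by (simp_all add: br_br_right_def additive_def br_at_add_left subst_map_add[OF module_pol]
      additive.add[OF additive_left] additive.add[OF additive_right]
      additive.add[OF additive_subst[OF module_pol additive_br_at(1)]])

lemma additive_br_br_left:
  "additive (\<lambda>a. br_br_left act br x y a b c)"
  "additive (\<lambda>b. br_br_left act br x y a b c)"
  "additive (\<lambda>c. br_br_left act br x y a b c)"
  by (simp_all add: br_br_left_def additive_def additive.add[OF additive_br_at(1)]
      additive.add[OF additive_left] additive.add[OF additive_right] subst_map_add[OF module_pol]
      additive.add[OF additive_subst[OF module_pol additive_br_at(2)]])

text \<open>
  In each of the three arguments, \<open>T\<^sub>i\<close> turns into a scalar.  When \<open>y\<close> in the second lemma is the sum of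
  the two parameters, the scalars agree with those of the first: \<open>-\<lambda>\<^sub>i\<close>, \<open>-\<mu>\<^sub>i\<close> and
  \<open>T\<^sub>i + \<lambda>\<^sub>i + \<mu>\<^sub>i\<close>.
\<close>

lemma br_br_right_T:
  "br_br_right act br x y (act (var i) a) b c = pol_scale act (- x i) (br_br_right act br x y a b c)"
  "br_br_right act br x y a (act (var i) b) c = pol_scale act (- y i) (br_br_right act br x y a b c)"
  "br_br_right act br x y a b (act (var i) c)
    = pol_scale act (const (var i) + x i + y i) (br_br_right act br x y a b c)"
proof -
  note sub = additive_subst[OF module_pol additive_br_at(1)]
  note sc = subst_scale_var[OF module_pol additive_br_at(1) module_axioms]
    subst_scale_const[OF module_pol additive_br_at(1) module_axioms]
  show "br_br_right act br x y (act (var i) a) b c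
      = pol_scale act (- x i) (br_br_right act br x y a b c)"
    by (simp only: br_br_right_def br_at_T_left pol.scale_minus_left[symmetric]
        subst_map_scale[OF module_pol])
  show "br_br_right act br x y a (act (var i) b) c
      = pol_scale act (- y i) (br_br_right act br x y a b c)"
    by (simp add: br_br_right_def sesqui_left additive.minus[OF sub] sc)
  show "br_br_right act br x y a b (act (var i) c)
    = pol_scale act (const (var i) + x i + y i) (br_br_right act br x y a b c)"
    by (simp add: br_br_right_def sesqui_right pol.scale_left_distrib additive.add[OF sub] sc
        br_at_T_right subst_map_add[OF module_pol] subst_map_scale[OF module_pol])
qed

lemma br_br_left_T:
  "br_br_left act br x y (act (var i) a) b c = pol_scale act (- x i) (br_br_left act br x y a b c)"
  "br_br_left act br x y a (act (var i) b) c
    = pol_scale act (x i - y i) (br_br_left act br x y a b c)"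
  "br_br_left act br x y a b (act (var i) c)
    = pol_scale act (const (var i) + y i) (br_br_left act br x y a b c)"
proof -
  note sub = additive_subst[OF module_pol additive_br_at(2)]
  note sc = subst_scale_var[OF module_pol additive_br_at(2) module_axioms]
    subst_scale_const[OF module_pol additive_br_at(2) module_axioms]
  show "br_br_left act br x y (act (var i) a) b c
      = pol_scale act (- x i) (br_br_left act br x y a b c)"
    by (simp add: br_br_left_def sesqui_left additive.minus[OF sub] sc)
  have "subst (pol_scale act) x (\<lambda>z. - pol_scale act (y i) (h z)) P
      = - pol_scale act (y i) (subst (pol_scale act) x h P)" for h P
    using subst_map_scale[OF module_pol, of x "- y i" h P] by simp
  then show "br_br_left act br x y a (act (var i) b) c
      = pol_scale act (x i - y i) (br_br_left act br x y a b c)"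
    by (simp add: br_br_left_def sesqui_right pol.scale_left_distrib additive.add[OF sub] sc
        br_at_T_left pol.scale_left_diff_distrib)
  show "br_br_left act br x y a b (act (var i) c)
    = pol_scale act (const (var i) + y i) (br_br_left act br x y a b c)"
    by (simp add: br_br_left_def br_at_T_right subst_map_scale[OF module_pol])
qed

end

text \<open>
  Passing from \<open>a\<close> to \<open>T\<^sub>i a\<close> multiplies the left side by \<open>-\<lambda>\<^sub>i\<close> and the right side by
  \<open>T\<^sub>i + \<nu>\<^sub>i\<close> with \<open>\<nu> = -\<lambda> - T\<close>, which is the same; passing from \<open>b\<close> to \<open>T\<^sub>i b\<close> multiplies them by
  \<open>T\<^sub>i + \<lambda>\<^sub>i = -\<nu>\<^sub>i\<close>.
\<close>

lemma skew_from_generators: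
  fixes scale :: "complex \<Rightarrow> 'v::ab_group_add \<Rightarrow> 'v"
    and br :: "('r::finite, 'v) pol \<Rightarrow> ('r, 'v) pol \<Rightarrow> ('r, ('r, 'v) pol) pol"
  assumes "module scale" "sesquilinear_bracket (pol_scale scale) br"
    and U: "0 \<in> U" "0 \<in> W" "\<And>m. Poly_Mapping.lookup A m \<in> U" "\<And>m. Poly_Mapping.lookup B m \<in> W"
    and gen: "\<And>a b. a \<in> U \<Longrightarrow> b \<in> W \<Longrightarrow> br (const a) (const b) =
      - sgnpow e (br_at (pol_scale scale) br (\<lambda>i. - (var i + const (var i))) (const b) (const a))"
  shows "br A B = - sgnpow e (br_at (pol_scale scale) br (\<lambda>i. - (var i + const (var i))) B A)"
proof -
  interpret sesquilinear_bracket "pol_scale scale" br by fact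
  note add = additive.add[OF additive_left] additive.add[OF additive_right]
    additive.add[OF additive_br_at(1)] additive.add[OF additive_br_at(2)]
  show ?thesis
    using \<open>module scale\<close> U(1,3)
  proof (induction A rule: polynomial_vector_induct)
    case (vector a)
    show ?case
      using \<open>module scale\<close> U(2,4)
    proof (induction B rule: polynomial_vector_induct)
      case (times i B)
      then show ?case
        by (simp add: sesqui_right br_at_T_left module_sgnpow_scale[OF module_pol]
          pol.scale_left_distrib pol.scale_left_diff_distrib)
    qed (simp_all add: gen vector add)
  next
    case (times i A)
    then show ?case
      by (simp add: sesqui_left br_at_T_right module_sgnpow_scale[OF module_pol])
  qed (simp add: add)
qed

text \<open>
  By \<open>br_br_right_T\<close> and \<open>br_br_left_T\<close>, the three terms acquire the same scalar when \<open>T\<^sub>i\<close> is applied to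
  one of the arguments.
\<close>

lemma jacobi_from_generators:
  fixes scale :: "complex \<Rightarrow> 'v::ab_group_add \<Rightarrow> 'v"
    and br :: "('r::finite, 'v) pol \<Rightarrow> ('r, 'v) pol \<Rightarrow> ('r, ('r, 'v) pol) pol"
    and x y :: "'r \<Rightarrow> ('y, ('r, complex) pol) pol"
  assumes "module scale" "sesquilinear_bracket (pol_scale scale) br"
    and U: "0 \<in> U" "0 \<in> W" "\<And>m. Poly_Mapping.lookup A m \<in> U" "\<And>m. Poly_Mapping.lookup B m \<in> W"
    and gen: "\<And>a b c. a \<in> U \<Longrightarrow> b \<in> W \<Longrightarrow>
      br_br_right (pol_scale scale) br x y (const a) (const b) (const c)
      = br_br_left (pol_scale scale) br x (\<lambda>i. x i + y i) (const a) (const b) (const c)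
        + sgnpow e (br_br_right (pol_scale scale) br y x (const b) (const a) (const c))"
  shows "br_br_right (pol_scale scale) br x y A B C
      = br_br_left (pol_scale scale) br x (\<lambda>i. x i + y i) A B C
        + sgnpow e (br_br_right (pol_scale scale) br y x B A C)"
proof -
  interpret sesquilinear_bracket "pol_scale scale" br by fact
  note add = additive_br_br_right[THEN additive.add] additive_br_br_left[THEN additive.add]
  note T = br_br_right_T br_br_left_T module_sgnpow_scale[OF module_pol, symmetric]
    pol.scale_right_distrib[symmetric]
  show ?thesis
    using \<open>module scale\<close> U(1,3)
  proof (induction A rule: polynomial_vector_induct)
    case (vector a)
    show ?case
      using \<open>module scale\<close> U(2,4)
    proof (induction B rule: polynomial_vector_induct)
      case (vector b)
      have "0 \<in> UNIV" "\<And>m. Poly_Mapping.lookup C m \<in> UNIV" by simp_all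
      with \<open>module scale\<close> show ?case
      proof (induction C rule: polynomial_vector_induct)
        case (times i C)
        have "const (var i) + y i + x i = const (var i) + x i + y i"
          "const (var i) + (x i + y i) = const (var i) + x i + y i"
          by (simp_all add: algebra_simps)
        then show ?case by (simp only: T times.IH)
      qed (simp_all add: gen vector \<open>a \<in> U\<close> add)
    next
      case (times i B)
      have "x i - (x i + y i) = - y i" by simp
      then show ?case by (simp only: T times.IH)
    qed (simp add: add)
  next
    case (times i A)
    show ?case by (simp only: T times.IH)
  qed (simp add: add)
qed

lemma sesquilinear_bracket_eqI:
  fixes scale :: "complex \<Rightarrow> 'v::ab_group_add \<Rightarrow> 'v"
    and br br' :: "('r::finite, 'v) pol \<Rightarrow> ('r, 'v) pol \<Rightarrow> ('r, ('r, 'v) pol) pol"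
  assumes "module scale" "sesquilinear_bracket (pol_scale scale) br"
    "sesquilinear_bracket (pol_scale scale) br'"
    and gen: "\<And>a b. br (const a) (const b) = br' (const a) (const b)"
  shows "br A B = br' A B"
proof -
  interpret br: sesquilinear_bracket "pol_scale scale" br by fact
  interpret br': sesquilinear_bracket "pol_scale scale" br' by fact
  have U: "0 \<in> UNIV" "\<And>m. Poly_Mapping.lookup P m \<in> UNIV" for P :: "('r, 'v) pol" by simp_all
  note add = additive.add[OF br.additive_left] additive.add[OF br'.additive_left]
    additive.add[OF br.additive_right] additive.add[OF br'.additive_right]
  show ?thesis
    using \<open>module scale\<close> U
  proof (induction A rule: polynomial_vector_induct)
    case (vector a)
    show ?case
      using \<open>module scale\<close> U
      by (induction B rule: polynomial_vector_induct)
        (simp_all add: gen add br.sesqui_right br'.sesqui_right)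
  qed (simp_all add: add br.sesqui_left br'.sesqui_left)
qed

section \<open>Brackets of generators\<close>

lemma lookup_single_one: "Poly_Mapping.lookup (Poly_Mapping.single i (1::nat)) m = (if i = m then 1 else 0)"
  by (simp add: lookup_single when_def)

lemma single_eq_iff: "Poly_Mapping.single i (1::nat) = Poly_Mapping.single k 1 \<longleftrightarrow> i = k"
proof
  assume eq: "Poly_Mapping.single i (1::nat) = Poly_Mapping.single k 1"
  then have "Poly_Mapping.lookup (Poly_Mapping.single i (1::nat)) i
    = Poly_Mapping.lookup (Poly_Mapping.single k (1::nat)) i" by simp
  then show "i = k" unfolding lookup_single_one by (cases "i = k") simp_all
qed simp

text \<open>
  A quadratic monomial determines its two variables up to order, so only the symmetric part of a
  quadratic form can be read off from its coefficients.
\<close>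

lemma single_add_single_eq_iff:
  "Poly_Mapping.single i (1::nat) + Poly_Mapping.single j 1 = Poly_Mapping.single k 1 + Poly_Mapping.single l 1
    \<longleftrightarrow> i = k \<and> j = l \<or> i = l \<and> j = k"
proof
  assume eq: "Poly_Mapping.single i (1::nat) + Poly_Mapping.single j 1
    = Poly_Mapping.single k 1 + Poly_Mapping.single l 1"
  have m: "(if i = m then 1 else 0) + (if j = m then 1 else 0)
      = (if k = m then 1 else 0) + (if l = m then 1 else (0::nat))" for m
    using arg_cong[OF eq, of "\<lambda>p. Poly_Mapping.lookup p m"]
    unfolding lookup_add lookup_single_one .
  show "i = k \<and> j = l \<or> i = l \<and> j = k"
  proof (cases "i = k")
    case True
    then show ?thesis using m[of j] by (cases "l = j") simp_all
  next
    case False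
    then have "i = l" using m[of i] by (cases "l = i") simp_all
    then show ?thesis using m[of j] by (cases "k = j") simp_all
  qed
qed (auto simp: add.commute)

lemma single_degrees:
  "Poly_Mapping.single i (1::nat) \<noteq> 0"
  "Poly_Mapping.single i (1::nat) + Poly_Mapping.single j 1 \<noteq> 0"
  "Poly_Mapping.single i (1::nat) + Poly_Mapping.single j 1 \<noteq> Poly_Mapping.single k 1"
proof -
  have lookup_ne: "p \<noteq> q" if "Poly_Mapping.lookup p m \<noteq> Poly_Mapping.lookup q m"
    for p q :: "'a \<Rightarrow>\<^sub>0 nat" and m
    using that by auto
  show "Poly_Mapping.single i (1::nat) \<noteq> 0"
    by (rule lookup_ne[of _ i]) simp
  show "Poly_Mapping.single i (1::nat) + Poly_Mapping.single j 1 \<noteq> 0"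
    by (rule lookup_ne[of _ i]) (simp add: lookup_add)
  show "Poly_Mapping.single i (1::nat) + Poly_Mapping.single j 1 \<noteq> Poly_Mapping.single k 1"
  proof (cases "i = k")
    case True
    then show ?thesis by (intro lookup_ne[of _ j]) (simp add: lookup_add)
  next
    case False
    then show ?thesis by (intro lookup_ne[of _ i]) (simp add: lookup_add lookup_single_one del: One_nat_def)
  qed
qed

text \<open>The embedding of \<open>V\<close> into the polynomials over \<open>R\<close>; their variables, indexed by \<open>'y\<close>, are \<open>\<lambda>\<close> alone
  or \<open>\<lambda>\<close> and \<open>\<mu>\<close>.\<close>

definition vec :: "'v::zero \<Rightarrow> ('y, ('r, 'v) pol) pol"
  where "vec v = const (const v)"

abbreviation T_var :: "'r \<Rightarrow> ('y, ('r, complex) pol) pol"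
  where "T_var \<equiv> \<lambda>i. const (var i)"

lemma additive_vec: "additive (vec :: 'v::ab_group_add \<Rightarrow> ('y, ('r, 'v) pol) pol)"
  by standard (simp add: vec_def const_def single_add)

text \<open>
  The polynomials over \<open>R\<close> form a free \<open>\<complex>[T][\<lambda>,\<mu>]\<close>-module over \<open>V\<close>.  Writing its elements of
  degree at most two through \<open>lin\<close> and \<open>bilin\<close>, whose first arguments are families of scalars, allows
  expansion and collection of terms for arbitrary parameters of the brackets.
\<close>

locale generator_calculus = V: module scale
  for scale :: "complex \<Rightarrow> 'v::ab_group_add \<Rightarrow> 'v"
begin

abbreviation poly_scale :: "('r, complex) pol \<Rightarrow> ('r, 'v) pol \<Rightarrow> ('r, 'v) pol"
  where "poly_scale \<equiv> pol_scale scale"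

abbreviation PS :: "('y, ('r, complex) pol) pol \<Rightarrow> ('y, ('r, 'v) pol) pol \<Rightarrow> ('y, ('r, 'v) pol) pol"
  where "PS \<equiv> pol_scale (pol_scale scale)"

lemma module_R: "module poly_scale"
  by (rule module_pol_scale[OF V.module_axioms])

lemma module_PS: "module PS"
  by (rule module_pol_scale[OF module_R])

sublocale R: module "poly_scale :: ('r, complex) pol \<Rightarrow> _"
  by (rule module_R)

sublocale M: module "PS :: ('y, ('r, complex) pol) pol \<Rightarrow> _"
  by (rule module_PS)

definition lin :: "('r::finite \<Rightarrow> ('y, ('r, complex) pol) pol) \<Rightarrow> ('r \<Rightarrow> 'v) \<Rightarrow> ('y, ('r, 'v) pol) pol"
  where "lin p F = (\<Sum>i\<in>UNIV. PS (p i) (vec (F i)))"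

definition bilin ::
  "('r::finite \<Rightarrow> ('y, ('r, complex) pol) pol) \<Rightarrow> ('r \<Rightarrow> ('y, ('r, complex) pol) pol)
    \<Rightarrow> ('r \<Rightarrow> 'r \<Rightarrow> 'v) \<Rightarrow> ('y, ('r, 'v) pol) pol"
  where "bilin p q F = (\<Sum>i\<in>UNIV. \<Sum>j\<in>UNIV. PS (p i * q j) (vec (F i j)))"

lemma lin_simps:
  "lin p (\<lambda>i. F i + G i) = lin p F + lin p G"
  "lin p (\<lambda>i. - F i) = - lin p F"
  "lin p (\<lambda>i. F i - G i) = lin p F - lin p G"
  "lin (\<lambda>i. p i - q i) F = lin p F - lin q F"
  "lin (\<lambda>i. p i + q i) F = lin p F + lin q F"
  "lin (\<lambda>i. - p i) F = - lin p F"
  "lin p (\<lambda>i. sgnpow e (F i)) = sgnpow e (lin p F)"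
  by (simp_all add: lin_def additive.add[OF additive_vec] additive.minus[OF additive_vec]
      additive.diff[OF additive_vec] M.scale_right_diff_distrib M.scale_left_diff_distrib sum_subtractf
      left_diff_distrib right_diff_distrib
      M.scale_right_distrib M.scale_left_distrib sum.distrib sum_negf sgnpow_def)

lemma bilin_simps:
  "bilin p q (\<lambda>i j. F i j + G i j) = bilin p q F + bilin p q G"
  "bilin p q (\<lambda>i j. - F i j) = - bilin p q F"
  "bilin p q (\<lambda>i j. F i j - G i j) = bilin p q F - bilin p q G"
  "bilin (\<lambda>i. p i - p' i) q F = bilin p q F - bilin p' q F"
  "bilin p (\<lambda>i. q i - q' i) F = bilin p q F - bilin p q' F"
  "bilin (\<lambda>i. p i + p' i) q F = bilin p q F + bilin p' q F"
  "bilin p (\<lambda>i. q i + q' i) F = bilin p q F + bilin p q' F"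
  "bilin (\<lambda>i. - p i) q F = - bilin p q F"
  "bilin p (\<lambda>i. - q i) F = - bilin p q F"
  "bilin p q (\<lambda>i j. sgnpow e (F i j)) = sgnpow e (bilin p q F)"
  by (simp_all add: bilin_def additive.add[OF additive_vec] additive.minus[OF additive_vec]
      additive.diff[OF additive_vec] M.scale_right_diff_distrib M.scale_left_diff_distrib sum_subtractf
      left_diff_distrib right_diff_distrib
      M.scale_right_distrib M.scale_left_distrib sum.distrib sum_negf distrib_left distrib_right sgnpow_def)

lemma bilin_swap: "bilin p q F = bilin q p (\<lambda>i j. F j i)"
  unfolding bilin_def by (subst sum.swap) (simp add: mult.commute)

text \<open>
  A quadratic form in a single family of scalars depends only on the symmetrization of its
  coefficients; here it matters that \<open>2\<close> is invertible.
\<close>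

lemma bilin_square_cong:
  assumes "\<And>i j. F i j + F j i = G i j + G j i"
  shows "bilin p p F = bilin p p G"
proof -
  have "bilin p p F + bilin p p F = bilin p p (\<lambda>i j. F i j + F j i)"
    by (simp add: bilin_simps flip: bilin_swap[of p p F])
  also have "\<dots> = bilin p p (\<lambda>i j. G i j + G j i)" by (simp only: assms)
  also have "\<dots> = bilin p p G + bilin p p G"
    by (simp add: bilin_simps flip: bilin_swap[of p p G])
  finally have "bilin p p F + bilin p p F = bilin p p G + bilin p p G" .
  then have "PS (const (const (1/2))) (bilin p p F + bilin p p F)
      = PS (const (const (1/2))) (bilin p p G + bilin p p G)" by simp
  moreover have "const (const (1/2)) + const (const (1/2)) = (1 :: ('y, ('r, complex) pol) pol)"
    by (simp add: const_def flip: single_add)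
  ultimately show ?thesis
    by (metis M.scale_left_distrib M.scale_one M.scale_right_distrib)
qed

lemma sum_scale_lin:
  "(\<Sum>j\<in>UNIV. PS (q j) (lin p (F j))) = bilin p q (\<lambda>i j. F j i)"
  unfolding bilin_def lin_def
  by (subst sum.swap) (simp add: M.scale_sum_right mult.commute)

lemma linear_form_eq_lin: "linear_form w u v = lin var w + lin T_var u + vec v"
proof -
  have "Poly_Mapping.single (Poly_Mapping.single i 1) x = pol_scale s (var i) (const x)"
    if "module s" for i x and s :: "'c::comm_ring_1 \<Rightarrow> 'm::ab_group_add \<Rightarrow> 'm"
    using pol_scale_var_single[OF that, of i 0 x] by (simp add: const_def)
  note single = this[OF module_R] this[OF V.module_axioms]
  show ?thesis
    unfolding linear_form_def lin_def vec_def single pol_scale_const_const[OF module_R] ..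
qed

lemma subst_linear_form:
  fixes h :: "('r::finite, 'v) pol \<Rightarrow> ('y, ('r, 'v) pol) pol"
  assumes h: "additive h"
  shows "subst PS x h (linear_form w u v)
    = (\<Sum>i\<in>UNIV. PS (x i) (h (const (w i)))) + (\<Sum>j\<in>UNIV. h (poly_scale (var j) (const (u j))))
      + h (const v)"
proof -
  interpret h: additive h by fact
  interpret sub: additive "subst PS x h" by (rule additive_subst[OF module_PS h])
  have h': "additive (\<lambda>z. h (poly_scale t z))" for t
    by standard (simp add: R.scale_right_distrib h.add)
  show ?thesis
    by (simp add: linear_form_eq_lin lin_def vec_def sub.add sub.sum
        subst_scale_var[OF module_PS h module_R] subst_scale_const[OF module_PS h module_R]
        subst_const[OF module_PS h] subst_const[OF module_PS h'])
qed

lemma lookup_vec: "Poly_Mapping.lookup (vec v) m = (const v when m = 0)"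
  "Poly_Mapping.lookup (const v) n = (v when n = 0)"
  by (simp_all add: vec_def const_def lookup_single when_def)

end

lemma lookup_linear:
  assumes "module s"
  shows "Poly_Mapping.lookup (\<Sum>i\<in>UNIV. pol_scale s (var i) (const (F (i::'r::finite)))) (Poly_Mapping.single k 1) = F k"
    "Poly_Mapping.lookup (\<Sum>i\<in>UNIV. pol_scale s (var i) (const (F i))) 0 = 0"
    "Poly_Mapping.lookup (\<Sum>i\<in>UNIV. pol_scale s (var i) (const (F i)))
      (Poly_Mapping.single k 1 + Poly_Mapping.single l 1) = 0"
proof -
  have eq: "pol_scale s (var i) (const (F i)) = Poly_Mapping.single (Poly_Mapping.single i 1) (F i)" for i
    using pol_scale_var_single[OF assms, of i 0 "F i"] by (simp add: const_def)
  show "Poly_Mapping.lookup (\<Sum>i\<in>UNIV. pol_scale s (var i) (const (F i))) (Poly_Mapping.single k 1) = F k"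
    "Poly_Mapping.lookup (\<Sum>i\<in>UNIV. pol_scale s (var i) (const (F i))) 0 = 0"
    "Poly_Mapping.lookup (\<Sum>i\<in>UNIV. pol_scale s (var i) (const (F i)))
      (Poly_Mapping.single k 1 + Poly_Mapping.single l 1) = 0"
    unfolding eq lookup_sum lookup_single
    by (simp_all add: when_def single_eq_iff single_degrees single_degrees[symmetric] del: One_nat_def)
qed

text \<open>
  The diagonal is exceptional: the monomial \<open>T\<^sub>k\<^sup>2\<close> arises from one pair of indices, a mixed one from two.
\<close>

lemma lookup_quadratic:
  assumes "module s"
  defines "P \<equiv> \<lambda>F. \<Sum>i\<in>UNIV. \<Sum>j\<in>UNIV. pol_scale s (var i * var j) (const (F i (j::'r::finite)))"
  shows "Poly_Mapping.lookup (P F) (Poly_Mapping.single k 1 + Poly_Mapping.single l 1)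
      = (if k = l then F k l else F k l + F l k)"
    "Poly_Mapping.lookup (P F) 0 = 0"
    "Poly_Mapping.lookup (P F) (Poly_Mapping.single k 1) = 0"
proof -
  have eq: "pol_scale s (var i * var j) (const x)
      = Poly_Mapping.single (Poly_Mapping.single i 1 + Poly_Mapping.single j 1) x" for i j x
    using pol_scale_single[OF assms(1), of "Poly_Mapping.single i 1 + Poly_Mapping.single j 1" 1 0 x]
    by (simp add: const_def var_def mult_single module.scale_one[OF assms(1)])
  show "Poly_Mapping.lookup (P F) 0 = 0" "Poly_Mapping.lookup (P F) (Poly_Mapping.single k 1) = 0"
    unfolding P_def eq lookup_sum lookup_single
    by (simp_all add: when_def single_degrees del: One_nat_def)
  have delta: "(\<Sum>i\<in>UNIV. \<Sum>j\<in>UNIV. if i = k' then if j = l' then F i j else 0 else 0) = F k' l'"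
    for k' l'
  proof -
    have "(\<Sum>i\<in>UNIV. \<Sum>j\<in>UNIV. if i = k' then if j = l' then F i j else 0 else 0)
      = (\<Sum>i\<in>UNIV. if i = k' then \<Sum>j\<in>UNIV. if j = l' then F i j else 0 else 0)"
      by (intro sum.cong) auto
    then show ?thesis by simp
  qed
  have "Poly_Mapping.lookup (P F) (Poly_Mapping.single k 1 + Poly_Mapping.single l 1)
    = (\<Sum>i\<in>UNIV. \<Sum>j\<in>UNIV. if i = k \<and> j = l \<or> i = l \<and> j = k then F i j else 0)"
    unfolding P_def eq lookup_sum lookup_single single_add_single_eq_iff when_def by simp
  also have "\<dots> = (\<Sum>i\<in>UNIV. \<Sum>j\<in>UNIV. (if i = k then if j = l then F i j else 0 else 0)
      + (if k = l then 0 else if i = l then if j = k then F i j else 0 else 0))"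
    by (intro sum.cong) auto
  also have "\<dots> = (if k = l then F k l else F k l + F l k)"
    unfolding sum.distrib delta by (cases "k = l") (simp_all only: delta simp_thms if_True if_False sum.neutral_const add_0_right)
  finally show "Poly_Mapping.lookup (P F) (Poly_Mapping.single k 1 + Poly_Mapping.single l 1)
      = (if k = l then F k l else F k l + F l k)" .
qed

text \<open>
  Here \<open>w\<close>, \<open>u\<close> and \<open>v\<close> are the coefficients of \<open>\<lambda>\<^sub>i\<close>, of \<open>T\<^sub>i\<close> and the constant one.  In one direction of
  the theorem they are read off from a given bracket, in the other one they are built from the
  operations.
\<close>

locale linear_bracket = generator_calculus scale + sesquilinear_bracket "pol_scale scale" br
  for scale :: "complex \<Rightarrow> 'v::ab_group_add \<Rightarrow> 'v"
    and br :: "('r::finite, 'v) pol \<Rightarrow> ('r, 'v) pol \<Rightarrow> ('r, ('r, 'v) pol) pol" +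
  fixes w u :: "'r \<Rightarrow> 'v \<Rightarrow> 'v \<Rightarrow> 'v" and v :: "'v \<Rightarrow> 'v \<Rightarrow> 'v"
  assumes br_const: "br (const a) (const b) = linear_form (\<lambda>i. w i a b) (\<lambda>i. u i a b) (v a b)"
    and additive_wuv: "additive (\<lambda>a. w i a b)" "additive (\<lambda>a. u i a b)" "additive (\<lambda>a. v a b)"
begin

lemma br_at_generators:
  "br_at (pol_scale scale) br x (const a) (const b)
    = lin x (\<lambda>i. w i a b) + lin T_var (\<lambda>i. u i a b) + vec (v a b)"
  unfolding br_at_def br_const subst_linear_form[OF additive_const]
  by (simp add: lin_def vec_def pol_scale_const_const[OF module_R])

text \<open>
  Since \<open>[a\<^sub>x T\<^sub>j z] = (T\<^sub>j + x\<^sub>j)[a\<^sub>x z]\<close>, the inner coefficient \<open>u\<^sub>j(b,c)\<close> contributes both to the terms with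
  \<open>T\<^sub>j\<close> and to those with \<open>x\<^sub>j\<close>.
\<close>

lemma br_br_right_generators:
  "br_br_right (pol_scale scale) br x y (const a) (const b) (const c)
    = bilin x x (\<lambda>i j. w i a (u j b c)) + bilin x y (\<lambda>i j. w i a (w j b c))
      + bilin x T_var (\<lambda>i j. w i a (u j b c) + u j a (u i b c)) + bilin y T_var (\<lambda>i j. u j a (w i b c))
      + bilin T_var T_var (\<lambda>i j. u i a (u j b c))
      + lin x (\<lambda>i. v a (u i b c) + w i a (v b c)) + lin y (\<lambda>i. v a (w i b c))
      + lin T_var (\<lambda>i. v a (u i b c) + u i a (v b c)) + vec (v a (v b c))"
proof -
  note h = additive_br_at(1)[of x "const a"]
  have step: "(\<Sum>j\<in>UNIV. PS (p j) (br_at (pol_scale scale) br x (const a) (const (z j))))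
    = bilin x p (\<lambda>i j. w i a (z j)) + bilin T_var p (\<lambda>i j. u i a (z j)) + lin p (\<lambda>j. v a (z j))"
    for p z
    by (simp add: br_at_generators M.scale_right_distrib sum.distrib sum_scale_lin) (simp add: lin_def)
  note swap = bilin_swap[of T_var x] bilin_swap[of T_var y]
  show ?thesis
    unfolding br_br_right_def br_const subst_linear_form[OF h] br_at_T_right step
    by (simp add: br_at_generators bilin_simps lin_simps swap)
qed

text \<open>
  Here \<open>T\<^sub>j u\<^sub>j(a,b)\<close> in the left slot acts as \<open>-(x\<^sub>j + y\<^sub>j)\<close>, so the coefficient of \<open>x\<^sub>j\<close> involves only the
  difference \<open>w\<^sub>j - u\<^sub>j\<close>.
\<close>

lemma br_br_left_generators:
  "br_br_left (pol_scale scale) br x (\<lambda>i. x i + y i) (const a) (const b) (const c)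
    = bilin x x (\<lambda>i j. w i (w j a b - u j a b) c)
      + bilin x y (\<lambda>i j. w j (w i a b - u i a b) c - w i (u j a b) c)
      - bilin y y (\<lambda>i j. w i (u j a b) c)
      + bilin x T_var (\<lambda>i j. u j (w i a b - u i a b) c) - bilin y T_var (\<lambda>i j. u j (u i a b) c)
      + lin x (\<lambda>i. v (w i a b - u i a b) c + w i (v a b) c)
      + lin y (\<lambda>i. w i (v a b) c - v (u i a b) c)
      + lin T_var (\<lambda>i. u i (v a b) c) + vec (v (v a b) c)"
proof -
  let ?z = "\<lambda>i. x i + y i"
  note h = additive_br_at(2)[of ?z "const c"]
  have step: "(\<Sum>j\<in>UNIV. PS (p j) (br_at (pol_scale scale) br ?z (const (z j)) (const c)))
    = bilin ?z p (\<lambda>i j. w i (z j) c) + bilin T_var p (\<lambda>i j. u i (z j) c) + lin p (\<lambda>j. v (z j) c)"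
    for p z
    by (simp add: br_at_generators M.scale_right_distrib sum.distrib sum_scale_lin) (simp add: lin_def)
  note swap = bilin_swap[of T_var x] bilin_swap[of T_var y] bilin_swap[of y x]
  show ?thesis
    unfolding br_br_left_def br_const subst_linear_form[OF h] br_at_T_left M.scale_minus_left[symmetric] step
    by (simp add: br_at_generators bilin_simps lin_simps swap additive.add[OF additive_wuv(1)]
       additive.add[OF additive_wuv(2)] additive.add[OF additive_wuv(3)]
       additive.diff[OF additive_wuv(1)] additive.diff[OF additive_wuv(2)] additive.diff[OF additive_wuv(3)])
qed

text \<open>
  Coefficientwise form of the Jacobi identity on generators.  The labels name the monomial:
  \<open>X\<close>, \<open>Y\<close> and \<open>T\<close> stand for \<open>x\<close>, \<open>y\<close> and \<open>T\<close> (with index \<open>i\<close> on the first factor and \<open>j\<close> on the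
  second), and \<open>C\<close> for the constant term.  The pure squares are symmetrized in \<open>i\<close> and \<open>j\<close>.
\<close>

lemma jacobi_generatorsI:
  assumes XX: "\<And>i j. w i a (u j b c) + w j a (u i b c)
      = w i (w j a b - u j a b) c + w j (w i a b - u i a b) c"
    and XY: "\<And>i j. w i a (w j b c)
      = w j (w i a b - u i a b) c - w i (u j a b) c + sgnpow e (w j b (w i a c))"
    and YY: "\<And>i j. w i (u j a b) c + w j (u i a b) c
      = sgnpow e (w i b (u j a c)) + sgnpow e (w j b (u i a c))"
    and XT: "\<And>i j. w i a (u j b c) + u j a (u i b c)
      = u j (w i a b - u i a b) c + sgnpow e (u j b (w i a c))"
    and YT: "\<And>i j. u j a (w i b c)
      = - u j (u i a b) c + sgnpow e (w i b (u j a c) + u j b (u i a c))"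
    and TT: "\<And>i j. u i a (u j b c) + u j a (u i b c)
      = sgnpow e (u i b (u j a c)) + sgnpow e (u j b (u i a c))"
    and X: "\<And>i. v a (u i b c) + w i a (v b c)
      = v (w i a b - u i a b) c + w i (v a b) c + sgnpow e (v b (w i a c))"
    and Y: "\<And>i. v a (w i b c)
      = w i (v a b) c - v (u i a b) c + sgnpow e (v b (u i a c) + w i b (v a c))"
    and T: "\<And>i. v a (u i b c) + u i a (v b c)
      = u i (v a b) c + sgnpow e (v b (u i a c) + u i b (v a c))"
    and C: "v a (v b c) = v (v a b) c + sgnpow e (v b (v a c))"
  shows "br_br_right (pol_scale scale) br x y (const a) (const b) (const c)
      = br_br_left (pol_scale scale) br x (\<lambda>i. x i + y i) (const a) (const b) (const c)
        + sgnpow e (br_br_right (pol_scale scale) br y x (const b) (const a) (const c))"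
proof -
  have xx: "bilin x x (\<lambda>i j. w i a (u j b c)) = bilin x x (\<lambda>i j. w i (w j a b - u j a b) c)"
    by (rule bilin_square_cong) (rule XX)
  have yy: "bilin y y (\<lambda>i j. w i (u j a b) c) = sgnpow e (bilin y y (\<lambda>i j. w i b (u j a c)))"
    unfolding bilin_simps(10)[symmetric] by (rule bilin_square_cong) (rule YY)
  have tt: "bilin T_var T_var (\<lambda>i j. u i a (u j b c))
      = sgnpow e (bilin T_var T_var (\<lambda>i j. u i b (u j a c)) :: ('y, ('r, 'v) pol) pol)"
    unfolding bilin_simps(10)[symmetric] by (rule bilin_square_cong) (rule TT)
  have v: "vec (v a (v b c)) = (vec (v (v a b) c) + sgnpow e (vec (v b (v a c))) :: ('y, ('r, 'v) pol) pol)"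
    by (simp only: C additive.add[OF additive_vec] additive_map_sgnpow[OF additive_vec])
  show ?thesis
    unfolding br_br_right_generators br_br_left_generators
    unfolding XY XT YT X Y T xx tt v
    unfolding bilin_swap[of y x]
    by (simp add: bilin_simps lin_simps yy)
qed

end

section \<open>Identities in generalized super Gel'fand-Dorfman algebras\<close>

context generalized_super_gelfand_dorfman_algebra
begin

sublocale bialgebra: super_gelfand_dorfman_bialgebra scale G lie "nov i" for i
  by (rule bialgebra)

text \<open>
  For \<open>i = j\<close> the two conditions on pairs become the Novikov axioms (the second one doubled), so the
  cases \<open>i = j\<close> and \<open>i \<noteq> j\<close> can be treated alike from here on.
\<close>

lemma left_symmetric_all:
  assumes "a \<in> G \<alpha>" "b \<in> G \<beta>" "c \<in> G \<gamma>"
  shows "nov i a (nov j b c) = nov j (nov i a b) c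
    + sgnpow (\<alpha> * \<beta>) (nov j b (nov i a c) - nov i (nov j b a) c)"
proof (cases "i = j")
  case True
  then show ?thesis
    using bialgebra.nov.left_symmetric[OF assms, of j]
    by (simp add: algebra_simps)
next
  case False
  then show ?thesis
    using cross_left_symmetric[OF False assms(1,2), of c] by (simp add: algebra_simps)
qed

lemma right_commute_all:
  assumes "a \<in> G \<alpha>" "b \<in> G \<beta>" "c \<in> G \<gamma>"
  shows "nov j (nov i c a) b + nov i (nov j c a) b
    = sgnpow (\<alpha> * \<beta>) (nov j (nov i c b) a + nov i (nov j c b) a)"
proof (cases "i = j")
  case True
  then show ?thesis
    using bialgebra.nov.right_commute[OF assms(3,1,2), of j] by simp
next
  case False
  then show ?thesis by (rule cross_right_commute) (fact assms)+
qed

text \<open>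
  The products that play the roles of \<open>u\<^sub>i\<close> and \<open>w\<^sub>i\<close> for the bracket to be constructed.
\<close>

abbreviation opp :: "'r \<Rightarrow> 'v \<Rightarrow> 'v \<Rightarrow> 'v"
  where "opp i \<equiv> super_opposite G (nov i)"

abbreviation anticomm :: "'r \<Rightarrow> 'v \<Rightarrow> 'v \<Rightarrow> 'v"
  where "anticomm i a b \<equiv> nov i a b + opp i a b"

lemma graded_opp: "graded_algebra scale G (opp i)"
  by (rule graded_algebra.graded_algebra_super_opposite[OF bialgebra.nov.graded_algebra_axioms])

lemmas additive_products =
  bialgebra.nov.linear_left[THEN module_hom_additive]
  bialgebra.nov.linear_right[THEN module_hom_additive]
  bialgebra.linear_left[THEN module_hom_additive] bialgebra.linear_right[THEN module_hom_additive]
  graded_opp[THEN graded_algebra.linear_left, THEN module_hom_additive]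
  graded_opp[THEN graded_algebra.linear_right, THEN module_hom_additive]

lemma bilinear_simps:
  "nov i (x + y) z = nov i x z + nov i y z" "nov i z (x + y) = nov i z x + nov i z y"
  "nov i (- x) z = - nov i x z" "nov i z (- x) = - nov i z x"
  "nov i (x - y) z = nov i x z - nov i y z" "nov i z (x - y) = nov i z x - nov i z y"
  "lie (x + y) z = lie x z + lie y z" "lie z (x + y) = lie z x + lie z y"
  "lie (- x) z = - lie x z" "lie z (- x) = - lie z x"
  "lie (x - y) z = lie x z - lie y z" "lie z (x - y) = lie z x - lie z y"
  "opp i (x + y) z = opp i x z + opp i y z" "opp i z (x + y) = opp i z x + opp i z y"
  "opp i (- x) z = - opp i x z" "opp i z (- x) = - opp i z x"
  "opp i (x - y) z = opp i x z - opp i y z" "opp i z (x - y) = opp i z x - opp i z y"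
  by (fact additive_products[THEN additive.add] additive_products[THEN additive.minus]
      additive_products[THEN additive.diff])+

lemma opp_homogeneous:
  "a \<in> G \<alpha> \<Longrightarrow> b \<in> G \<beta> \<Longrightarrow> opp i a b = sgnpow (\<alpha> * \<beta>) (nov i b a)"
  by (rule graded_algebra.super_opposite_homogeneous[OF bialgebra.nov.graded_algebra_axioms])

context
  fixes \<alpha> \<beta> \<gamma> :: bit and a b c :: 'v
  assumes hom: "a \<in> G \<alpha>" "b \<in> G \<beta>" "c \<in> G \<gamma>"
begin

lemmas product_grades =
  bialgebra.nov.mult_grade[OF hom(1,2)] bialgebra.nov.mult_grade[OF hom(1,3)]
  bialgebra.nov.mult_grade[OF hom(2,3)]
  bialgebra.nov.mult_grade[OF hom(2,1), unfolded add.commute[of \<beta> \<alpha>]]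
  bialgebra.nov.mult_grade[OF hom(3,1), unfolded add.commute[of \<gamma> \<alpha>]]
  bialgebra.nov.mult_grade[OF hom(3,2), unfolded add.commute[of \<gamma> \<beta>]]
  bialgebra.mult_grade[OF hom(1,2)] bialgebra.mult_grade[OF hom(1,3)] bialgebra.mult_grade[OF hom(2,3)]

text \<open>
  For three fixed homogeneous elements all identities below are verified by normalization: these
  rules remove the super-opposite products, and the relations that follow are oriented as rewrite
  rules on the finitely many remaining words in \<open>a\<close>, \<open>b\<close> and \<open>c\<close>.
\<close>

lemma opp_products:
  "opp i a b = sgnpow (\<alpha> * \<beta>) (nov i b a)"
  "opp i b c = sgnpow (\<beta> * \<gamma>) (nov i c b)"
  "opp i a c = sgnpow (\<alpha> * \<gamma>) (nov i c a)"
  "opp i a (nov j b c) = sgnpow (\<alpha> * (\<beta> + \<gamma>)) (nov i (nov j b c) a)"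
  "opp i a (nov j c b) = sgnpow (\<alpha> * (\<beta> + \<gamma>)) (nov i (nov j c b) a)"
  "opp i b (nov j a c) = sgnpow (\<beta> * (\<alpha> + \<gamma>)) (nov i (nov j a c) b)"
  "opp i b (nov j c a) = sgnpow (\<beta> * (\<alpha> + \<gamma>)) (nov i (nov j c a) b)"
  "opp i (nov j a b) c = sgnpow ((\<alpha> + \<beta>) * \<gamma>) (nov i c (nov j a b))"
  "opp i (nov j b a) c = sgnpow ((\<alpha> + \<beta>) * \<gamma>) (nov i c (nov j b a))"
  "opp i a (lie b c) = sgnpow (\<alpha> * (\<beta> + \<gamma>)) (nov i (lie b c) a)"
  "opp i b (lie a c) = sgnpow (\<beta> * (\<alpha> + \<gamma>)) (nov i (lie a c) b)"
  "opp i (lie a b) c = sgnpow ((\<alpha> + \<beta>) * \<gamma>) (nov i c (lie a b))"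
  by (rule opp_homogeneous; fact hom product_grades)+

text \<open>
  Left symmetry pairs the twelve words \<open>x \<circ>\<^sub>i (y \<circ>\<^sub>j z)\<close> (over both orders of the indices) and removes one
  of each pair; the words with \<open>x\<close> before \<open>y\<close> in the order \<open>a\<close>, \<open>b\<close>, \<open>c\<close> remain.  Right
  commutativity removes one word \<open>(x \<circ> y) \<circ> z\<close> for each \<open>x\<close>.  The last three rules must be used with one
  order of \<open>i\<close> and \<open>j\<close> only, since otherwise they undo each other.
\<close>

lemma novikov_relations:
  "nov i b (nov j a c) = nov j (nov i b a) c + sgnpow (\<alpha> * \<beta>) (nov j a (nov i b c) - nov i (nov j a b) c)"
  "nov i c (nov j a b) = nov j (nov i c a) b + sgnpow (\<alpha> * \<gamma>) (nov j a (nov i c b) - nov i (nov j a c) b)"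
  "nov i c (nov j b a) = nov j (nov i c b) a + sgnpow (\<beta> * \<gamma>) (nov j b (nov i c a) - nov i (nov j b c) a)"
  "nov i (nov j a c) b = sgnpow (\<beta> * \<gamma>) (nov i (nov j a b) c + nov j (nov i a b) c) - nov j (nov i a c) b"
  "nov i (nov j b c) a = sgnpow (\<alpha> * \<gamma>) (nov i (nov j b a) c + nov j (nov i b a) c) - nov j (nov i b c) a"
  "nov i (nov j c b) a = sgnpow (\<alpha> * \<beta>) (nov i (nov j c a) b + nov j (nov i c a) b) - nov j (nov i c b) a"
  using left_symmetric_all[OF hom(2,1,3), of i j] left_symmetric_all[OF hom(3,1,2), of i j]
    left_symmetric_all[OF hom(3,2,1), of i j]
    right_commute_all[OF hom(3,2,1), of i j] right_commute_all[OF hom(3,1,2), of i j]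
    right_commute_all[OF hom(2,1,3), of i j]
  by (auto simp: mult.commute eq_diff_eq)

text \<open>
  The quadratic coefficients of the Jacobi identity.  In each of the eight cases for the degrees both
  sides have the same normal form.
\<close>

lemma coefficient_XX:
  "anticomm i a (opp j b c) + anticomm j a (opp i b c)
    = anticomm i (nov j a b) c + anticomm j (nov i a b) c"
  using bit_cases[of \<alpha>] bit_cases[of \<beta>] bit_cases[of \<gamma>]
  by (elim disjE)
    (simp_all add: bilinear_simps opp_products bit_1_plus_1 novikov_relations(1-3)[of i j]
      novikov_relations(1-3)[of j i] novikov_relations(4-6)[of i j] algebra_simps)

lemma coefficient_XY:
  "anticomm i a (anticomm j b c)
    = anticomm j (nov i a b) c - anticomm i (opp j a b) c + sgnpow (\<alpha> * \<beta>) (anticomm j b (anticomm i a c))"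
  using bit_cases[of \<alpha>] bit_cases[of \<beta>] bit_cases[of \<gamma>]
  by (elim disjE)
    (simp_all add: bilinear_simps opp_products bit_1_plus_1 novikov_relations(1-3)[of i j]
      novikov_relations(1-3)[of j i] novikov_relations(4-6)[of i j] algebra_simps)

lemma coefficient_YY:
  "anticomm i (opp j a b) c + anticomm j (opp i a b) c
    = sgnpow (\<alpha> * \<beta>) (anticomm i b (opp j a c)) + sgnpow (\<alpha> * \<beta>) (anticomm j b (opp i a c))"
  using bit_cases[of \<alpha>] bit_cases[of \<beta>] bit_cases[of \<gamma>]
  by (elim disjE)
    (simp_all add: bilinear_simps opp_products bit_1_plus_1 novikov_relations(1-3)[of i j]
      novikov_relations(1-3)[of j i] novikov_relations(4-6)[of i j] algebra_simps)

lemma coefficient_XT: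
  "anticomm i a (opp j b c) + opp j a (opp i b c)
    = opp j (nov i a b) c + sgnpow (\<alpha> * \<beta>) (opp j b (anticomm i a c))"
  using bit_cases[of \<alpha>] bit_cases[of \<beta>] bit_cases[of \<gamma>]
  by (elim disjE)
    (simp_all add: bilinear_simps opp_products bit_1_plus_1 novikov_relations(1-3)[of i j]
      novikov_relations(1-3)[of j i] novikov_relations(4-6)[of i j] algebra_simps)

lemma coefficient_YT:
  "opp j a (anticomm i b c)
    = - opp j (opp i a b) c + sgnpow (\<alpha> * \<beta>) (anticomm i b (opp j a c) + opp j b (opp i a c))"
  using bit_cases[of \<alpha>] bit_cases[of \<beta>] bit_cases[of \<gamma>]
  by (elim disjE)
    (simp_all add: bilinear_simps opp_products bit_1_plus_1 novikov_relations(1-3)[of i j]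
      novikov_relations(1-3)[of j i] novikov_relations(4-6)[of i j] algebra_simps)

lemma coefficient_TT:
  "opp i a (opp j b c) + opp j a (opp i b c)
    = sgnpow (\<alpha> * \<beta>) (opp i b (opp j a c)) + sgnpow (\<alpha> * \<beta>) (opp j b (opp i a c))"
  using bit_cases[of \<alpha>] bit_cases[of \<beta>] bit_cases[of \<gamma>]
  by (elim disjE)
    (simp_all add: bilinear_simps opp_products bit_1_plus_1 novikov_relations(1-3)[of i j]
      novikov_relations(1-3)[of j i] novikov_relations(4-6)[of i j] algebra_simps)

text \<open>
  Skew-symmetry orders the arguments of the Lie operation, and compatibility removes the words
  \<open>x \<circ> [y,z]\<close>; these relations normalize the words with one operation of each kind.
\<close>

lemma lie_relations:
  "lie b a = - sgnpow (\<alpha> * \<beta>) (lie a b)"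
  "lie c a = - sgnpow (\<alpha> * \<gamma>) (lie a c)"
  "lie c b = - sgnpow (\<beta> * \<gamma>) (lie b c)"
  "lie a (nov i b c) = - sgnpow (\<alpha> * (\<beta> + \<gamma>)) (lie (nov i b c) a)"
  "lie a (nov i c b) = - sgnpow (\<alpha> * (\<beta> + \<gamma>)) (lie (nov i c b) a)"
  "lie b (nov i a c) = - sgnpow (\<beta> * (\<alpha> + \<gamma>)) (lie (nov i a c) b)"
  "lie b (nov i c a) = - sgnpow (\<beta> * (\<alpha> + \<gamma>)) (lie (nov i c a) b)"
  by (rule bialgebra.skew[where \<alpha> = \<beta> and \<beta> = \<alpha>, unfolded mult.commute[of \<beta> \<alpha>]]
      bialgebra.skew[where \<alpha> = \<gamma> and \<beta> = \<alpha>, unfolded mult.commute[of \<gamma> \<alpha>]]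
      bialgebra.skew[where \<alpha> = \<gamma> and \<beta> = \<beta>, unfolded mult.commute[of \<gamma> \<beta>]]
      bialgebra.skew; fact hom product_grades)+

lemma compat_relations:
  "nov i a (lie b c) = lie (nov i a b) c + nov i (lie a b) c
    - sgnpow (\<beta> * \<gamma>) (lie (nov i a c) b) - sgnpow (\<beta> * \<gamma>) (nov i (lie a c) b)"
  "nov i b (lie a c) = lie (nov i b a) c + nov i (lie b a) c
    - sgnpow (\<alpha> * \<gamma>) (lie (nov i b c) a) - sgnpow (\<alpha> * \<gamma>) (nov i (lie b c) a)"
  "nov i c (lie a b) = lie (nov i c a) b + nov i (lie c a) b
    - sgnpow (\<alpha> * \<beta>) (lie (nov i c b) a) - sgnpow (\<alpha> * \<beta>) (nov i (lie c b) a)"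
  using bialgebra.compat[OF hom(2,3), of i a] bialgebra.compat[OF hom(1,3), of i b]
    bialgebra.compat[OF hom(1,2), of i c]
  by (simp_all only: diff_eq_eq eq_diff_eq add_0_left) (simp_all add: algebra_simps)

text \<open>
  The linear coefficients of the Jacobi identity, by the same method.
\<close>

lemma coefficient_X:
  "lie a (opp i b c) + anticomm i a (lie b c)
    = lie (nov i a b) c + anticomm i (lie a b) c + sgnpow (\<alpha> * \<beta>) (lie b (anticomm i a c))"
  using bit_cases[of \<alpha>] bit_cases[of \<beta>] bit_cases[of \<gamma>]
  by (elim disjE)
    (simp_all add: bilinear_simps opp_products bit_1_plus_1 lie_relations compat_relations algebra_simps)

lemma coefficient_Y:
  "lie a (anticomm i b c)
    = anticomm i (lie a b) c - lie (opp i a b) c + sgnpow (\<alpha> * \<beta>) (lie b (opp i a c) + anticomm i b (lie a c))"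
  using bit_cases[of \<alpha>] bit_cases[of \<beta>] bit_cases[of \<gamma>]
  by (elim disjE)
    (simp_all add: bilinear_simps opp_products bit_1_plus_1 lie_relations compat_relations algebra_simps)

lemma coefficient_T:
  "lie a (opp i b c) + opp i a (lie b c)
    = opp i (lie a b) c + sgnpow (\<alpha> * \<beta>) (lie b (opp i a c) + opp i b (lie a c))"
  using bit_cases[of \<alpha>] bit_cases[of \<beta>] bit_cases[of \<gamma>]
  by (elim disjE)
    (simp_all add: bilinear_simps opp_products bit_1_plus_1 lie_relations compat_relations algebra_simps)

end
end

section \<open>From operations to the bracket\<close>

lemma const_ring_hom:
  "const (a + b) = const a + const b" "const (a * b) = const a * const b" "const 1 = 1"
  by (simp_all add: const_def single_add mult_single)

lemma module_const_action: "module act \<Longrightarrow> module (\<lambda>c. act (const c))"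
  unfolding module_def by (simp add: const_ring_hom)

text \<open>
  If \<open>A = \<Sum>\<^sub>m T\<^sup>m a\<^sub>m\<close> and \<open>B = \<Sum>\<^sub>n T\<^sup>n b\<^sub>n\<close>, this is \<open>\<Sum>\<^sub>m\<^sub>,\<^sub>n (-\<lambda>)\<^sup>m (T + \<lambda>)\<^sup>n L(a\<^sub>m, b\<^sub>n)\<close>, the only value that
  sesquilinearity permits.
\<close>

definition sesquilinear_extension ::
  "(complex \<Rightarrow> 'v::ab_group_add \<Rightarrow> 'v) \<Rightarrow> ('v \<Rightarrow> 'v \<Rightarrow> ('r::finite, ('r, 'v) pol) pol)
    \<Rightarrow> ('r, 'v) pol \<Rightarrow> ('r, 'v) pol \<Rightarrow> ('r, ('r, 'v) pol) pol"
  where "sesquilinear_extension scale L A B =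
    subst (pol_scale (pol_scale scale)) (\<lambda>i. - var i)
      (\<lambda>a. subst (pol_scale (pol_scale scale)) (\<lambda>i. const (var i) + var i) (L a) B) A"

locale bilinear_generators = generator_calculus scale
  for scale :: "complex \<Rightarrow> 'v::ab_group_add \<Rightarrow> 'v" +
  fixes L :: "'v \<Rightarrow> 'v \<Rightarrow> ('r::finite, ('r, 'v) pol) pol"
  assumes L_right: "module_hom scale (\<lambda>c. PS (const (const c))) (L a)"
    and L_left: "module_hom scale (\<lambda>c. PS (const (const c))) (\<lambda>a. L a b)"
begin

abbreviation ext :: "('r, 'v) pol \<Rightarrow> ('r, 'v) pol \<Rightarrow> ('r, ('r, 'v) pol) pol"
  where "ext \<equiv> sesquilinear_extension scale L"

lemmas L_add = additive.add[OF module_hom_additive[OF L_right]]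
  additive.add[OF module_hom_additive[OF L_left]]

lemma L_scale: "L (scale c a) b = PS (const (const c)) (L a b)" "L a (scale c b) = PS (const (const c)) (L a b)"
  using module_hom.scale[OF L_left] module_hom.scale[OF L_right] by auto

abbreviation inner :: "'v \<Rightarrow> ('r, 'v) pol \<Rightarrow> ('r, ('r, 'v) pol) pol"
  where "inner a \<equiv> subst PS (\<lambda>i. const (var i) + var i) (L a)"

lemma inner_add: "inner (a + a') B = inner a B + inner a' B"
proof -
  have "L (a + a') = (\<lambda>b. L a b + L a' b)" by (simp add: fun_eq_iff L_add)
  then show ?thesis by (simp add: subst_map_add[OF module_PS])
qed

lemma inner_scale: "inner (scale c a) B = PS (const (const c)) (inner a B)"
proof -
  have "L (scale c a) = (\<lambda>b. PS (const (const c)) (L a b))" by (simp add: fun_eq_iff L_scale)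
  then show ?thesis by (simp add: subst_map_scale[OF module_PS])
qed

lemma additive_inner: "additive (\<lambda>a. inner a B)"
  by standard (rule inner_add)

lemma inner_right:
  "inner a (B + B') = inner a B + inner a B'"
  "inner a (pol_scale scale (var i) B) = PS (const (var i) + var i) (inner a B)"
  "inner a (pol_scale scale (const c) B) = PS (const (const c)) (inner a B)"
proof -
  note L = module_hom_additive[OF L_right]
  show "inner a (B + B') = inner a B + inner a B'"
    by (rule additive.add[OF additive_subst[OF module_PS L]])
  show "inner a (pol_scale scale (var i) B) = PS (const (var i) + var i) (inner a B)"
    by (rule subst_scale_var[OF module_PS L V.module_axioms])
  show "inner a (pol_scale scale (const c) B) = PS (const (const c)) (inner a B)"
    by (simp add: subst_scale_const[OF module_PS L V.module_axioms] L_scale subst_map_scale[OF module_PS])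
qed

lemma ext_const: "ext (const a) (const b) = L a b"
  by (simp add: sesquilinear_extension_def subst_const[OF module_PS additive_inner]
      subst_const[OF module_PS module_hom_additive[OF L_right]]
      subst_const[OF module_PS module_hom_additive[OF L_left]])

lemma sesquilinear_bracket_ext: "sesquilinear_bracket (pol_scale scale) ext"
proof (intro sesquilinear_bracket.intro sesquilinear_bracket_axioms.intro)
  show "module (pol_scale scale :: ('r, complex) pol \<Rightarrow> _)" by (rule module_R)
  show "additive (ext A)" for A
    by standard (simp add: sesquilinear_extension_def inner_right subst_map_add[OF module_PS])
  show "additive (\<lambda>A. ext A B)" for B
    unfolding sesquilinear_extension_def by (rule additive_subst[OF module_PS additive_inner])
  show "ext (pol_scale scale (var i) A) B = - PS (var i) (ext A B)" for i A B
    by (simp add: sesquilinear_extension_def subst_scale_var[OF module_PS additive_inner V.module_axioms])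
  show "ext A (pol_scale scale (var i) B) = PS (const (var i) + var i) (ext A B)" for i A B
    by (simp add: sesquilinear_extension_def inner_right subst_map_scale[OF module_PS])
qed

lemma module_hom_ext:
  "module_hom (\<lambda>c. pol_scale scale (const c)) (\<lambda>c. PS (const (const c))) (ext A)"
  "module_hom (\<lambda>c. pol_scale scale (const c)) (\<lambda>c. PS (const (const c))) (\<lambda>A. ext A B)"
proof -
  interpret sesquilinear_bracket "pol_scale scale" ext by (rule sesquilinear_bracket_ext)
  have right: "ext A (pol_scale scale (const c) B) = PS (const (const c)) (ext A B)" for A B c
    by (simp add: sesquilinear_extension_def inner_right subst_map_scale[OF module_PS])
  have left: "ext (pol_scale scale (const c) A) B = PS (const (const c)) (ext A B)" for A B c
    by (simp add: sesquilinear_extension_def subst_scale_const[OF module_PS additive_inner V.module_axioms]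
        inner_scale subst_map_scale[OF module_PS])
  show "module_hom (\<lambda>c. pol_scale scale (const c)) (\<lambda>c. PS (const (const c))) (ext A)"
    "module_hom (\<lambda>c. pol_scale scale (const c)) (\<lambda>c. PS (const (const c))) (\<lambda>A. ext A B)"
    unfolding module_hom_iff
    using module_const_action[OF module_R] module_const_action[OF module_const_action[OF module_PS]]
    by (simp_all add: right left additive.add[OF additive_right] additive.add[OF additive_left])
qed

text \<open>
  The polynomials with coefficients in one homogeneous part form a submodule, so multiplication by
  the scalars that come from \<open>T\<^sub>i\<close> does not leave it.
\<close>

lemma ext_grade:
  assumes G: "graded_module scale G"
    and L: "\<And>a b. a \<in> G \<alpha> \<Longrightarrow> b \<in> G \<beta> \<Longrightarrow> L a b \<in> pol_grade (pol_grade G) \<gamma>"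
    and AB: "A \<in> pol_grade G \<alpha>" "B \<in> pol_grade G \<beta>"
  shows "ext A B \<in> pol_grade (pol_grade G) \<gamma>"
proof -
  interpret G: graded_module scale G by fact
  interpret N: graded_module "PS :: ('r, ('r, complex) pol) pol \<Rightarrow> _" "pol_grade (pol_grade G)"
    by (intro graded_module_pol G)
  interpret sesquilinear_bracket "pol_scale scale" ext by (rule sesquilinear_bracket_ext)
  note closed = M.subspace_add[OF N.subspace_grade] M.subspace_neg[OF N.subspace_grade]
    M.subspace_scale[OF N.subspace_grade]
  note add = additive.add[OF additive_left] additive.add[OF additive_right]
  have A: "\<And>m. Poly_Mapping.lookup A m \<in> G \<alpha>" and B: "\<And>m. Poly_Mapping.lookup B m \<in> G \<beta>"
    using AB by (simp_all add: pol_grade_def)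
  show ?thesis
    using V.module_axioms G.grade_0 A
  proof (induction A rule: polynomial_vector_induct)
    case (vector a)
    show ?case
      using V.module_axioms G.grade_0 B
      by (induction B rule: polynomial_vector_induct)
        (simp_all add: ext_const L vector sesqui_right add closed)
  qed (simp_all add: sesqui_left add closed)
qed

end

lemma (in generator_calculus) linear_form_grade:
  fixes w u :: "'r::finite \<Rightarrow> 'v"
  assumes G: "graded_module scale G"
    and "\<And>i. w i \<in> G \<gamma>" "\<And>i. u i \<in> G \<gamma>" "v \<in> G \<gamma>"
  shows "linear_form w u v \<in> pol_grade (pol_grade G) \<gamma>"
proof -
  interpret G: graded_module scale G by fact
  interpret R: graded_module "poly_scale :: ('r, complex) pol \<Rightarrow> _" "pol_grade G"
    by (intro graded_module_pol G)
  interpret N: graded_module "PS :: ('r, ('r, complex) pol) pol \<Rightarrow> _" "pol_grade (pol_grade G)"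
    by (intro graded_module_pol G)
  have vec: "(vec x :: ('r, ('r, 'v) pol) pol) \<in> pol_grade (pol_grade G) \<gamma>" if "x \<in> G \<gamma>" for x
    unfolding vec_def by (intro pol_grade_const G.grade_0 R.grade_0 that)
  show ?thesis
    unfolding linear_form_eq_lin lin_def
    by (intro M.subspace_add[OF N.subspace_grade] M.subspace_sum[OF N.subspace_grade]
        M.subspace_scale[OF N.subspace_grade] vec assms)
qed

lemma linear_form_coefficients:
  "Poly_Mapping.lookup (Poly_Mapping.lookup (linear_form w u v) (Poly_Mapping.single k 1)) 0 = w k"
  "Poly_Mapping.lookup (Poly_Mapping.lookup (linear_form w u v) 0) (Poly_Mapping.single k 1) = u k"
  "Poly_Mapping.lookup (Poly_Mapping.lookup (linear_form w u v) 0) 0 = v"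
proof -
  have lookup_if: "Poly_Mapping.lookup (if c then P else 0) n = (if c then Poly_Mapping.lookup P n else 0)"
    for c n and P :: "'x \<Rightarrow>\<^sub>0 'y::zero"
    by simp
  note simps = linear_form_def const_def lookup_add lookup_sum lookup_single when_def single_eq_iff
    single_degrees single_degrees[symmetric] lookup_if
  show "Poly_Mapping.lookup (Poly_Mapping.lookup (linear_form w u v) (Poly_Mapping.single k 1)) 0 = w k"
    "Poly_Mapping.lookup (Poly_Mapping.lookup (linear_form w u v) 0) (Poly_Mapping.single k 1) = u k"
    "Poly_Mapping.lookup (Poly_Mapping.lookup (linear_form w u v) 0) 0 = v"
    by (simp_all add: simps del: One_nat_def)
qed

context generalized_super_gelfand_dorfman_algebra
begin

definition generator_bracket :: "'v \<Rightarrow> 'v \<Rightarrow> ('r, ('r, 'v) pol) pol"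
  where "generator_bracket a b = linear_form (\<lambda>i. anticomm i a b) (\<lambda>i. opp i a b) (lie a b)"

abbreviation bracket :: "('r, 'v) pol \<Rightarrow> ('r, 'v) pol \<Rightarrow> ('r, ('r, 'v) pol) pol"
  where "bracket \<equiv> sesquilinear_extension scale generator_bracket"

sublocale generator_calculus scale
  by unfold_locales

sublocale bilinear_generators scale generator_bracket
proof (intro bilinear_generators.intro bilinear_generators_axioms.intro)
  show "generator_calculus scale" by (rule generator_calculus_axioms)
  have vec_scale: "vec (scale c x) = (PS (const (const c)) (vec x) :: ('r, ('r, 'v) pol) pol)" for c x
    by (simp add: vec_def pol_scale_const_const[OF module_R] pol_scale_const_const[OF bialgebra.module_axioms])
  have lin_scale: "lin p (\<lambda>i. scale c (F i)) = PS (const (const c)) (lin p F)"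
    for p :: "'r \<Rightarrow> ('r, ('r, complex) pol) pol" and c F
    by (simp add: lin_def vec_scale M.scale_sum_right mult.commute)
  note scale = module_hom.scale[OF bialgebra.nov.linear_left] module_hom.scale[OF bialgebra.nov.linear_right]
    module_hom.scale[OF bialgebra.linear_left] module_hom.scale[OF bialgebra.linear_right]
    module_hom.scale[OF graded_algebra.linear_left[OF graded_opp]]
    module_hom.scale[OF graded_algebra.linear_right[OF graded_opp]]
  show "module_hom scale (\<lambda>c. PS (const (const c))) (generator_bracket a)"
    "module_hom scale (\<lambda>c. PS (const (const c))) (\<lambda>b. generator_bracket b a)" for a
    unfolding module_hom_iff
    using module_const_action[OF module_const_action[OF module_PS]] bialgebra.module_axioms
    by (simp_all add: generator_bracket_def linear_form_eq_lin bilinear_simps lin_simps scale lin_scale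
        vec_scale additive.add[OF additive_vec] M.scale_right_distrib
        flip: bialgebra.scale_right_distrib)
qed

sublocale linear_bracket scale bracket anticomm opp lie
proof -
  interpret sesquilinear_bracket "pol_scale scale" bracket by (rule sesquilinear_bracket_ext)
  show "linear_bracket scale bracket anticomm opp lie"
    by unfold_locales (simp_all add: ext_const generator_bracket_def bilinear_simps algebra_simps)
qed

lemma corresponds_bracket: "corresponds G bracket lie nov"
  unfolding corresponds_def by (auto simp: ext_const generator_bracket_def opp_homogeneous)

text \<open>
  Substituting \<open>-\<lambda> - T\<close> for \<open>\<lambda>\<close> subtracts the coefficients of \<open>\<lambda>\<^sub>i\<close> from those of \<open>T\<^sub>i\<close>; the form
  \<open>a \<circ>\<^sub>i b + (-1)\<^sup>\<alpha>\<^sup>\<beta> b \<circ>\<^sub>i a\<close> of the former is made such that the result is the bracket with exchanged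
  arguments.
\<close>

lemma skew_generators:
  assumes "a \<in> G \<alpha>" "b \<in> G \<beta>"
  shows "bracket (const a) (const b) = - sgnpow (\<alpha> * \<beta>)
    (br_at (pol_scale scale) bracket (\<lambda>i. - (var i + const (var i))) (const b) (const a))"
proof -
  have opp: "opp i a b = sgnpow (\<alpha> * \<beta>) (nov i b a)" "opp i b a = sgnpow (\<alpha> * \<beta>) (nov i a b)" for i
    using opp_homogeneous[OF assms] opp_homogeneous[OF assms(2,1)] by (simp_all add: mult.commute)
  have lie: "lie b a = - sgnpow (\<alpha> * \<beta>) (lie a b)"
    using bialgebra.skew[OF assms(2,1)] by (simp add: mult.commute)
  show ?thesis
    unfolding ext_const generator_bracket_def linear_form_eq_lin br_at_generators opp lie
    by (simp add: lin_simps sgnpow_def additive.minus[OF additive_vec])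
qed

lemma jacobi_generators:
  fixes x y :: "'r \<Rightarrow> ('y, ('r, complex) pol) pol"
  assumes "a \<in> G \<alpha>" "b \<in> G \<beta>"
  shows "br_br_right (pol_scale scale) bracket x y (const a) (const b) (const c)
      = br_br_left (pol_scale scale) bracket x (\<lambda>i. x i + y i) (const a) (const b) (const c)
        + sgnpow (\<alpha> * \<beta>) (br_br_right (pol_scale scale) bracket y x (const b) (const a) (const c))"
proof (rule bialgebra.additive_ext)
  note add = additive_br_br_right[THEN additive.add] additive_br_br_left[THEN additive.add]
    additive.add[OF additive_const]
  show "additive (\<lambda>c. br_br_right (pol_scale scale) bracket x y (const a) (const b) (const c))"
    "additive (\<lambda>c. br_br_left (pol_scale scale) bracket x (\<lambda>i. x i + y i) (const a) (const b) (const c)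
        + sgnpow (\<alpha> * \<beta>) (br_br_right (pol_scale scale) bracket y x (const b) (const a) (const c)))"
    by (simp_all add: additive_def add)
  fix \<gamma> c assume "c \<in> G \<gamma>"
  note hom = assms this
  have diff: "anticomm i a b - opp i a b = nov i a b" for i by simp
  show "br_br_right (pol_scale scale) bracket x y (const a) (const b) (const c)
      = br_br_left (pol_scale scale) bracket x (\<lambda>i. x i + y i) (const a) (const b) (const c)
        + sgnpow (\<alpha> * \<beta>) (br_br_right (pol_scale scale) bracket y x (const b) (const a) (const c))"
    by (rule jacobi_generatorsI, unfold diff)
      (rule coefficient_XX[OF hom] coefficient_XY[OF hom] coefficient_YY[OF hom]
        coefficient_XT[OF hom] coefficient_YT[OF hom] coefficient_TT[OF hom]
        coefficient_X[OF hom] coefficient_Y[OF hom] coefficient_T[OF hom]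
        bialgebra.jacobi[OF assms])+
qed

lemma linear_lie_conformal_superalgebra_bracket:
  "linear_lie_conformal_superalgebra scale G bracket"
proof -
  interpret R: graded_module "poly_scale :: ('r, complex) pol \<Rightarrow> _" "pol_grade G"
    by (intro graded_module_pol bialgebra.graded_module_axioms)
  note sb = sesquilinear_bracket_ext
  show ?thesis
  proof (intro linear_lie_conformal_superalgebra.intro lie_conformal_superalgebra.intro
      linear_lie_conformal_superalgebra_axioms.intro lie_conformal_superalgebra_axioms.intro)
    show "graded_module scale G" by (rule bialgebra.graded_module_axioms)
    show "graded_module (poly_scale :: ('r, complex) pol \<Rightarrow> _) (pol_grade G)"
      by (rule R.graded_module_axioms)
    show "module_hom (\<lambda>c. pol_scale scale (const c)) (\<lambda>c. PS (const (const c))) (bracket A)"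
      "module_hom (\<lambda>c. pol_scale scale (const c)) (\<lambda>c. PS (const (const c))) (\<lambda>A. bracket A B)" for A B
      by (rule module_hom_ext)+
    show "Poly_Mapping.lookup (bracket A B) m \<in> pol_grade G (\<alpha> + \<beta>)"
      if "A \<in> pol_grade G \<alpha>" "B \<in> pol_grade G \<beta>" for \<alpha> \<beta> A B m
    proof -
      have "generator_bracket a b \<in> pol_grade (pol_grade G) (\<alpha> + \<beta>)" if "a \<in> G \<alpha>" "b \<in> G \<beta>" for a b
        unfolding generator_bracket_def using that
        by (intro linear_form_grade bialgebra.graded_module_axioms bialgebra.subspace_add[OF bialgebra.subspace_grade]
            bialgebra.mult_grade bialgebra.nov.mult_grade graded_algebra.mult_grade[OF graded_opp])
      from ext_grade[OF bialgebra.graded_module_axioms this that] show ?thesis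
        by (simp add: pol_grade_def[of "pol_grade G"])
    qed
    show "bracket (pol_scale scale (var i) A) B = - PS (var i) (bracket A B)"
      "bracket A (pol_scale scale (var i) B) = PS (const (var i) + var i) (bracket A B)" for i A B
      by (rule sesqui_left sesqui_right)+
    show "bracket A B = - sgnpow (\<alpha> * \<beta>)
        (br_at (pol_scale scale) bracket (\<lambda>i. - (var i + const (var i))) B A)"
      if "A \<in> pol_grade G \<alpha>" "B \<in> pol_grade G \<beta>" for \<alpha> \<beta> A B
    proof (rule skew_from_generators[OF bialgebra.module_axioms sb bialgebra.grade_0 bialgebra.grade_0])
      show "Poly_Mapping.lookup A m \<in> G \<alpha>" "Poly_Mapping.lookup B m \<in> G \<beta>" for m
        using that by (simp_all add: pol_grade_def)
    qed (rule skew_generators)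
    show "br_br_right (pol_scale scale) bracket (\<lambda>i. var (Inl i)) (\<lambda>i. var (Inr i)) A B C
      = br_br_left (pol_scale scale) bracket (\<lambda>i. var (Inl i)) (\<lambda>i. var (Inl i) + var (Inr i)) A B C
        + sgnpow (\<alpha> * \<beta>)
            (br_br_right (pol_scale scale) bracket (\<lambda>i. var (Inr i)) (\<lambda>i. var (Inl i)) B A C)"
      if "A \<in> pol_grade G \<alpha>" "B \<in> pol_grade G \<beta>" for \<alpha> \<beta> A B C
    proof (rule jacobi_from_generators[OF bialgebra.module_axioms sb bialgebra.grade_0 bialgebra.grade_0])
      show "Poly_Mapping.lookup A m \<in> G \<alpha>" "Poly_Mapping.lookup B m \<in> G \<beta>" for m
        using that by (simp_all add: pol_grade_def)
    qed (rule jacobi_generators)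
    show "\<exists>w u v. bracket (const a) (const b) = linear_form w u v" for a b
      unfolding br_const by blast
  qed
qed

end

lemma (in linear_lie_conformal_superalgebra) sesquilinear_bracket:
  "sesquilinear_bracket (pol_scale scale) br"
proof (intro sesquilinear_bracket.intro sesquilinear_bracket_axioms.intro)
  show "module (pol_scale scale :: ('r, complex) pol \<Rightarrow> _)"
    by (rule module_pol_scale[OF V.module_axioms])
  show "additive (br a)" "additive (\<lambda>a. br a b)" for a b
    by (rule module_hom_additive[OF linear_right] module_hom_additive[OF linear_left])+
qed (fact sesqui_left sesqui_right)+

lemma correspondsD:
  assumes "corresponds V br lie nov" "a \<in> V \<alpha>" "b \<in> V \<beta>"
  shows "br (const a) (const b) =
    linear_form (\<lambda>i. nov i a b + sgnpow (\<alpha> * \<beta>) (nov i b a))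
      (\<lambda>j. sgnpow (\<alpha> * \<beta>) (nov j b a)) (lie a b)"
  using assms unfolding corresponds_def by blast

lemma bracket_unique:
  assumes "linear_lie_conformal_superalgebra scale V br" "linear_lie_conformal_superalgebra scale V br'"
    and "corresponds V br lie nov" "corresponds V br' lie nov"
  shows "br = br'"
proof (intro ext)
  fix A B
  interpret br: linear_lie_conformal_superalgebra scale V br by fact
  interpret br': linear_lie_conformal_superalgebra scale V br' by fact
  interpret s: sesquilinear_bracket "pol_scale scale" br by (rule br.sesquilinear_bracket)
  interpret s': sesquilinear_bracket "pol_scale scale" br' by (rule br'.sesquilinear_bracket)
  note add = additive.add[OF s.additive_left] additive.add[OF s'.additive_left]
    additive.add[OF s.additive_right] additive.add[OF s'.additive_right] additive.add[OF additive_const]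
  have "br (const a) (const b) = br' (const a) (const b)" for a b
  proof (rule br.V.biadditive_ext[where f = "\<lambda>a b. br (const a) (const b)"
      and g = "\<lambda>a b. br' (const a) (const b)"])
    show "br (const a) (const b) = br' (const a) (const b)" if "a \<in> V \<alpha>" "b \<in> V \<beta>" for \<alpha> \<beta> a b
      by (rule trans[OF correspondsD[OF assms(3) that] correspondsD[OF assms(4) that, symmetric]])
  qed (simp_all add: additive_def add)
  then show "br A B = br' A B"
    by (rule sesquilinear_bracket_eqI[OF br.V.module_axioms s.sesquilinear_bracket_axioms
        s'.sesquilinear_bracket_axioms])
qed

section \<open>From the bracket to operations\<close>

lemma lookup_sgnpow: "Poly_Mapping.lookup (sgnpow e P) m = sgnpow e (Poly_Mapping.lookup P m)"
  by (simp add: sgnpow_def)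

lemma lookup_scale_var_low:
  assumes "module act"
  shows "Poly_Mapping.lookup (pol_scale act (var i) P) 0 = 0"
    "Poly_Mapping.lookup (pol_scale act (var i) P) (Poly_Mapping.single k 1)
      = (if i = k then Poly_Mapping.lookup P 0 else 0)"
proof -
  show "Poly_Mapping.lookup (pol_scale act (var i) P) 0 = 0"
    by (rule lookup_scale_var(2)[OF assms]) simp
  show "Poly_Mapping.lookup (pol_scale act (var i) P) (Poly_Mapping.single k 1)
      = (if i = k then Poly_Mapping.lookup P 0 else 0)"
  proof (cases "i = k")
    case True
    then show ?thesis using lookup_scale_var(1)[OF assms, of i P 0] by simp
  next
    case False
    then show ?thesis
      by (simp add: lookup_scale_var(2)[OF assms] lookup_single_one del: One_nat_def)
  qed
qed

context generator_calculus
begin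

abbreviation lam :: "'r \<Rightarrow> ('r + 'r, ('r, complex) pol) pol"
  where "lam \<equiv> \<lambda>i. var (Inl i)"

abbreviation mu :: "'r \<Rightarrow> ('r + 'r, ('r, complex) pol) pol"
  where "mu \<equiv> \<lambda>i. var (Inr i)"

lemma scale_mult: "PS (p * q) z = PS p (PS q z)"
  by simp

lemmas outer_simps = lin_def bilin_def lookup_sum lookup_scale_var_low[OF module_R]
  lookup_scale_const[OF module_R] lookup_vec when_def

lemma lookup_lin_0:
  "Poly_Mapping.lookup (lin (\<lambda>i. var (f i)) F) 0 = 0"
  "Poly_Mapping.lookup (lin T_var F) 0 = (\<Sum>i\<in>UNIV. poly_scale (var i) (const (F i)))"
  by (simp_all add: outer_simps)

lemma lookup_bilin_0:
  "Poly_Mapping.lookup (bilin (\<lambda>i. var (f i)) q F) 0 = 0"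
  "Poly_Mapping.lookup (bilin T_var T_var F) 0
    = (\<Sum>i\<in>UNIV. \<Sum>j\<in>UNIV. poly_scale (var i * var j) (const (F i j)))"
  by (simp_all add: outer_simps scale_mult del: M.scale_scale R.scale_scale)
    (simp add: outer_simps)

lemma lookup_lin_Inl:
  "Poly_Mapping.lookup (lin lam F) (Poly_Mapping.single (Inl k) 1) = const (F k)"
  "Poly_Mapping.lookup (lin mu F) (Poly_Mapping.single (Inl k) 1) = 0"
  "Poly_Mapping.lookup (lin T_var F) (Poly_Mapping.single (Inl k) 1) = 0"
  by (simp_all add: outer_simps single_degrees del: One_nat_def)

lemma lookup_bilin_Inl:
  "Poly_Mapping.lookup (bilin lam T_var F) (Poly_Mapping.single (Inl k) 1)
    = (\<Sum>j\<in>UNIV. poly_scale (var j) (const (F k j)))"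
  "Poly_Mapping.lookup (bilin mu q F) (Poly_Mapping.single (Inl k) 1) = 0"
  "Poly_Mapping.lookup (bilin T_var T_var F) (Poly_Mapping.single (Inl k) 1) = 0"
  "Poly_Mapping.lookup (bilin lam (\<lambda>i. var (f i)) F) (Poly_Mapping.single (Inl k) 1) = 0"
proof -
  have sum_if: "(\<Sum>j\<in>A. if c then f j else 0) = (if c then \<Sum>j\<in>A. f j else 0)"
    for c A and f :: "'x \<Rightarrow> 'y::comm_monoid_add"
    by simp
  show "Poly_Mapping.lookup (bilin lam T_var F) (Poly_Mapping.single (Inl k) 1)
    = (\<Sum>j\<in>UNIV. poly_scale (var j) (const (F k j)))"
    by (simp add: outer_simps scale_mult single_degrees sum_if del: M.scale_scale R.scale_scale One_nat_def)
  show "Poly_Mapping.lookup (bilin mu q F) (Poly_Mapping.single (Inl k) 1) = 0"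
    "Poly_Mapping.lookup (bilin lam (\<lambda>i. var (f i)) F) (Poly_Mapping.single (Inl k) 1) = 0"
    "Poly_Mapping.lookup (bilin T_var T_var F) (Poly_Mapping.single (Inl k) 1) = 0"
    by (simp_all add: outer_simps scale_mult single_degrees sum_if
        del: M.scale_scale R.scale_scale One_nat_def cong: if_cong)
qed

lemma lookup_vec_low:
  "Poly_Mapping.lookup (vec x) 0 = const x"
  "Poly_Mapping.lookup (vec x) (Poly_Mapping.single (Inl k) 1) = 0"
  by (simp_all add: lookup_vec single_degrees del: One_nat_def)

lemma lookup_const_low:
  "Poly_Mapping.lookup (const x) 0 = x"
  "Poly_Mapping.lookup (const x) (Poly_Mapping.single k (1::nat)) = 0"
  "Poly_Mapping.lookup (const x) (Poly_Mapping.single k (1::nat) + Poly_Mapping.single l 1) = 0"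
  by (simp_all add: const_def lookup_single when_def single_degrees[symmetric] del: One_nat_def)

lemmas inner_lookups = lookup_linear[OF V.module_axioms] lookup_quadratic[OF V.module_axioms]
  lookup_const_low lookup_add lookup_minus lookup_sgnpow

lemmas outer_lookups = lookup_lin_0 lookup_bilin_0 lookup_lin_Inl lookup_bilin_Inl
  lookup_vec_low lookup_add lookup_minus lookup_sgnpow

end

text \<open>
  Four of the coefficients suffice to recover the operations' axioms: those of \<open>T\<^sub>iT\<^sub>j\<close> and \<open>T\<^sub>i\<close> and the
  constant one are found at \<open>\<lambda> = \<mu> = 0\<close>, the one of \<open>\<lambda>\<^sub>iT\<^sub>j\<close> in the \<open>\<lambda>\<^sub>i\<close>-linear part.
\<close>

lemma (in linear_bracket) jacobi_coefficients:
  assumes jacobi: "br_br_right (pol_scale scale) br lam mu (const a) (const b) (const c)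
      = br_br_left (pol_scale scale) br lam (\<lambda>i. lam i + mu i) (const a) (const b) (const c)
        + sgnpow e (br_br_right (pol_scale scale) br mu lam (const b) (const a) (const c))"
  shows "u i a (u j b c) + u j a (u i b c) = sgnpow e (u i b (u j a c) + u j b (u i a c))"
    and "u i a (u i b c) = sgnpow e (u i b (u i a c))"
    and "w i a (u j b c) + u j a (u i b c) = u j (w i a b - u i a b) c + sgnpow e (u j b (w i a c))"
    and "v a (u i b c) + u i a (v b c) = u i (v a b) c + sgnpow e (v b (u i a c) + u i b (v a c))"
    and "v a (v b c) = v (v a b) c + sgnpow e (v b (v a c))"
proof -
  note J = jacobi[unfolded br_br_right_generators br_br_left_generators bilin_swap[of mu lam]]
  note T = arg_cong[OF J, of "\<lambda>P. Poly_Mapping.lookup P 0", unfolded outer_lookups]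
  note L = arg_cong[OF J, of "\<lambda>P. Poly_Mapping.lookup P (Poly_Mapping.single (Inl i) 1)", unfolded outer_lookups]
  have sq: "u i a (u i b c) = sgnpow e (u i b (u i a c))" for i
    using arg_cong[OF T, of "\<lambda>P. Poly_Mapping.lookup P (Poly_Mapping.single i 1 + Poly_Mapping.single i 1)"]
    unfolding inner_lookups by simp
  show "u i a (u i b c) = sgnpow e (u i b (u i a c))" by (rule sq)
  show "u i a (u j b c) + u j a (u i b c) = sgnpow e (u i b (u j a c) + u j b (u i a c))"
  proof (cases "i = j")
    case True
    then show ?thesis using sq[of j] by simp
  next
    case False
    then show ?thesis
      using arg_cong[OF T, of "\<lambda>P. Poly_Mapping.lookup P (Poly_Mapping.single i 1 + Poly_Mapping.single j 1)"]
      unfolding inner_lookups by simp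
  qed
  show "v a (u i b c) + u i a (v b c) = u i (v a b) c + sgnpow e (v b (u i a c) + u i b (v a c))"
    using arg_cong[OF T, of "\<lambda>P. Poly_Mapping.lookup P (Poly_Mapping.single i 1)"]
    unfolding inner_lookups by simp
  show "v a (v b c) = v (v a b) c + sgnpow e (v b (v a c))"
    using arg_cong[OF T, of "\<lambda>P. Poly_Mapping.lookup P 0"]
    unfolding inner_lookups by simp
  show "w i a (u j b c) + u j a (u i b c) = u j (w i a b - u i a b) c + sgnpow e (u j b (w i a c))"
    using arg_cong[OF L, of "\<lambda>P. Poly_Mapping.lookup P (Poly_Mapping.single j 1)"]
    unfolding inner_lookups by simp
qed

lemma (in linear_bracket) skew_coefficients:
  assumes skew: "br (const a) (const b) = - sgnpow e
    (br_at (pol_scale scale) br (\<lambda>i. - (var i + const (var i))) (const b) (const a))"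
  shows "u i a b = sgnpow e (w i b a - u i b a)" "v a b = - sgnpow e (v b a)"
proof -
  have eq: "linear_form (\<lambda>i. w i a b) (\<lambda>i. u i a b) (v a b)
    = linear_form (\<lambda>i. sgnpow e (w i b a)) (\<lambda>i. sgnpow e (w i b a - u i b a)) (- sgnpow e (v b a))"
    using skew unfolding br_const br_at_generators linear_form_eq_lin
    by (simp add: lin_simps sgnpow_def additive.minus[OF additive_vec] split: if_splits)
  show "u i a b = sgnpow e (w i b a - u i b a)" "v a b = - sgnpow e (v b a)"
    using arg_cong[OF eq, of "\<lambda>P. Poly_Mapping.lookup (Poly_Mapping.lookup P 0) (Poly_Mapping.single i 1)"]
      arg_cong[OF eq, of "\<lambda>P. Poly_Mapping.lookup (Poly_Mapping.lookup P 0) 0"]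
    unfolding linear_form_coefficients by blast+
qed

context linear_lie_conformal_superalgebra
begin

definition T_coeff :: "'r \<Rightarrow> 'v \<Rightarrow> 'v \<Rightarrow> 'v"
  where "T_coeff i a b = Poly_Mapping.lookup (Poly_Mapping.lookup (br (const a) (const b)) 0) (Poly_Mapping.single i 1)"

definition lambda_coeff :: "'r \<Rightarrow> 'v \<Rightarrow> 'v \<Rightarrow> 'v"
  where "lambda_coeff i a b = Poly_Mapping.lookup (Poly_Mapping.lookup (br (const a) (const b)) (Poly_Mapping.single i 1)) 0"

definition constant_coeff :: "'v \<Rightarrow> 'v \<Rightarrow> 'v"
  where "constant_coeff a b = Poly_Mapping.lookup (Poly_Mapping.lookup (br (const a) (const b)) 0) 0"

lemma bracket_generators:
  "br (const a) (const b) = linear_form (\<lambda>i. lambda_coeff i a b) (\<lambda>i. T_coeff i a b) (constant_coeff a b)"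
proof -
  obtain w u v where "br (const a) (const b) = linear_form w u v" using br_linear by blast
  then show ?thesis
    by (simp add: lambda_coeff_def T_coeff_def constant_coeff_def linear_form_coefficients del: One_nat_def)
qed

lemma graded_algebra_coefficient:
  "graded_algebra scale V (\<lambda>a b. Poly_Mapping.lookup (Poly_Mapping.lookup (br (const a) (const b)) m) n)"
proof -
  note R = module_pol_scale[OF V.module_axioms]
  have add: "br (A + A') B = br A B + br A' B" "br A (B + B') = br A B + br A B'" for A A' B B'
    using module_hom.add[OF linear_left] module_hom.add[OF linear_right] by auto
  have scale: "br (const (scale c a)) B = pol_scale (pol_scale scale) (const (const c)) (br (const a) B)"
    "br B (const (scale c a)) = pol_scale (pol_scale scale) (const (const c)) (br B (const a))" for B c a
    using module_hom.scale[OF linear_left] module_hom.scale[OF linear_right]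
    by (simp_all flip: pol_scale_const_const[OF V.module_axioms])
  show ?thesis
  proof (intro graded_algebra.intro graded_algebra_axioms.intro V.graded_module_axioms)
    show "module_hom scale scale (\<lambda>b. Poly_Mapping.lookup (Poly_Mapping.lookup (br (const a) (const b)) m) n)"
      "module_hom scale scale (\<lambda>b. Poly_Mapping.lookup (Poly_Mapping.lookup (br (const b) (const a)) m) n)" for a
      unfolding module_hom_iff using V.module_axioms
      by (simp_all add: add scale additive.add[OF additive_const] lookup_add lookup_scale_const[OF R]
          lookup_scale_const[OF V.module_axioms])
    show "Poly_Mapping.lookup (Poly_Mapping.lookup (br (const a) (const b)) m) n \<in> V (\<alpha> + \<beta>)"
      if "a \<in> V \<alpha>" "b \<in> V \<beta>" for \<alpha> \<beta> a b
      using br_grade[OF pol_grade_const pol_grade_const, OF V.grade_0 that(1) V.grade_0 that(2)]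
      by (simp add: pol_grade_def)
  qed
qed

lemmas graded_T_coeff = graded_algebra_coefficient[of 0 "Poly_Mapping.single i 1" for i, folded T_coeff_def]
lemmas graded_lambda_coeff = graded_algebra_coefficient[of "Poly_Mapping.single i 1" 0 for i, folded lambda_coeff_def]
lemmas graded_constant_coeff = graded_algebra_coefficient[of 0 0, folded constant_coeff_def]


text \<open>The operation \<open>\<circ>\<^sub>i\<close>.\<close>

abbreviation circ :: "'r \<Rightarrow> 'v \<Rightarrow> 'v \<Rightarrow> 'v"
  where "circ i \<equiv> super_opposite V (T_coeff i)"

lemma graded_circ: "graded_algebra scale V (circ i)"
  by (rule graded_algebra.graded_algebra_super_opposite[OF graded_T_coeff])

lemma linear_bracket: "linear_bracket scale br lambda_coeff T_coeff constant_coeff"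
proof (intro linear_bracket.intro linear_bracket_axioms.intro generator_calculus.intro
    V.module_axioms sesquilinear_bracket bracket_generators)
  show "additive (\<lambda>a. lambda_coeff i a b)" "additive (\<lambda>a. T_coeff i a b)"
    "additive (\<lambda>a. constant_coeff a b)" for i b
    by (rule module_hom_additive graded_algebra.linear_left graded_lambda_coeff graded_T_coeff
        graded_constant_coeff)+
qed

lemma skew_homogeneous:
  assumes "a \<in> V \<alpha>" "b \<in> V \<beta>"
  shows "T_coeff i a b = sgnpow (\<alpha> * \<beta>) (circ i b a)"
    and "lambda_coeff i a b = circ i a b + T_coeff i a b"
    and "constant_coeff a b = - sgnpow (\<alpha> * \<beta>) (constant_coeff b a)"
proof -
  note grade = pol_grade_const[where G = V, OF V.grade_0 assms(1)] pol_grade_const[where G = V, OF V.grade_0 assms(2)]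
  note skew = linear_bracket.skew_coefficients[OF linear_bracket conformal_skew[OF grade]]
    linear_bracket.skew_coefficients[OF linear_bracket conformal_skew[OF grade(2,1)]]
  note opp = graded_algebra.super_opposite_homogeneous[OF graded_T_coeff]
  show "T_coeff i a b = sgnpow (\<alpha> * \<beta>) (circ i b a)"
    unfolding opp[OF assms(2,1)] by (simp add: sgnpow_def mult.commute)
  show "lambda_coeff i a b = circ i a b + T_coeff i a b"
    unfolding opp[OF assms] skew(3)[of i] by (simp add: sgnpow_def mult.commute)
  show "constant_coeff a b = - sgnpow (\<alpha> * \<beta>) (constant_coeff b a)"
    by (rule skew(2))
qed

lemmas additive_products =
  graded_circ[THEN graded_algebra.linear_left, THEN module_hom_additive]
  graded_circ[THEN graded_algebra.linear_right, THEN module_hom_additive]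
  graded_T_coeff[THEN graded_algebra.linear_left, THEN module_hom_additive]
  graded_T_coeff[THEN graded_algebra.linear_right, THEN module_hom_additive]
  graded_lambda_coeff[THEN graded_algebra.linear_right, THEN module_hom_additive]
  graded_constant_coeff[THEN graded_algebra.linear_left, THEN module_hom_additive]
  graded_constant_coeff[THEN graded_algebra.linear_right, THEN module_hom_additive]

lemma coefficient_simps:
  "circ i (x + y) z = circ i x z + circ i y z" "circ i z (x + y) = circ i z x + circ i z y"
  "circ i (- x) z = - circ i x z" "circ i z (- x) = - circ i z x"
  "circ i (x - y) z = circ i x z - circ i y z" "circ i z (x - y) = circ i z x - circ i z y"
  "constant_coeff (x + y) z = constant_coeff x z + constant_coeff y z"
  "constant_coeff z (x + y) = constant_coeff z x + constant_coeff z y"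
  "constant_coeff (- x) z = - constant_coeff x z" "constant_coeff z (- x) = - constant_coeff z x"
  "constant_coeff (x - y) z = constant_coeff x z - constant_coeff y z" "constant_coeff z (x - y) = constant_coeff z x - constant_coeff z y"
  "T_coeff i (x + y) z = T_coeff i x z + T_coeff i y z" "T_coeff i z (x + y) = T_coeff i z x + T_coeff i z y"
  "lambda_coeff i z (- x) = - lambda_coeff i z x"
  "T_coeff i (- x) z = - T_coeff i x z" "T_coeff i z (- x) = - T_coeff i z x"
  "T_coeff i (x - y) z = T_coeff i x z - T_coeff i y z" "T_coeff i z (x - y) = T_coeff i z x - T_coeff i z y"
  by (fact additive_products[THEN additive.add] additive_products[THEN additive.minus]
      additive_products[THEN additive.diff])+

context
  fixes \<alpha> \<beta> \<gamma> :: bit and a b c :: 'v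
  assumes hom: "a \<in> V \<alpha>" "b \<in> V \<beta>" "c \<in> V \<gamma>"
begin

lemma jacobi_homogeneous:
  shows "T_coeff i a (T_coeff j b c) + T_coeff j a (T_coeff i b c)
      = sgnpow (\<alpha> * \<beta>) (T_coeff i b (T_coeff j a c) + T_coeff j b (T_coeff i a c))"
    and "T_coeff i a (T_coeff i b c) = sgnpow (\<alpha> * \<beta>) (T_coeff i b (T_coeff i a c))"
    and "lambda_coeff i a (T_coeff j b c) + T_coeff j a (T_coeff i b c)
      = T_coeff j (lambda_coeff i a b - T_coeff i a b) c + sgnpow (\<alpha> * \<beta>) (T_coeff j b (lambda_coeff i a c))"
    and "constant_coeff a (T_coeff i b c) + T_coeff i a (constant_coeff b c)
      = T_coeff i (constant_coeff a b) c
        + sgnpow (\<alpha> * \<beta>) (constant_coeff b (T_coeff i a c) + T_coeff i b (constant_coeff a c))"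
    and "constant_coeff a (constant_coeff b c)
      = constant_coeff (constant_coeff a b) c + sgnpow (\<alpha> * \<beta>) (constant_coeff b (constant_coeff a c))"
  by (fact linear_bracket.jacobi_coefficients[OF linear_bracket conformal_jacobi, OF
      pol_grade_const[where G = V, OF V.grade_0 hom(1)] pol_grade_const[where G = V, OF V.grade_0 hom(2)]])+

lemmas product_grades =
  graded_algebra.mult_grade[OF graded_circ hom(1,2)] graded_algebra.mult_grade[OF graded_circ hom(1,3)]
  graded_algebra.mult_grade[OF graded_circ hom(3,1), unfolded add.commute[of \<gamma> \<alpha>]]
  graded_algebra.mult_grade[OF graded_circ hom(3,2), unfolded add.commute[of \<gamma> \<beta>]]
  graded_algebra.mult_grade[OF graded_constant_coeff hom(1,2)]
  graded_algebra.mult_grade[OF graded_constant_coeff hom(3,1), unfolded add.commute[of \<gamma> \<alpha>]]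
  graded_algebra.mult_grade[OF graded_constant_coeff hom(3,2), unfolded add.commute[of \<gamma> \<beta>]]

lemma T_products:
  "T_coeff i a b = sgnpow (\<alpha> * \<beta>) (circ i b a)"
  "T_coeff i a c = sgnpow (\<alpha> * \<gamma>) (circ i c a)"
  "T_coeff i b c = sgnpow (\<beta> * \<gamma>) (circ i c b)"
  "T_coeff i a (circ j c b) = sgnpow (\<alpha> * (\<beta> + \<gamma>)) (circ i (circ j c b) a)"
  "T_coeff i b (circ j c a) = sgnpow (\<beta> * (\<alpha> + \<gamma>)) (circ i (circ j c a) b)"
  "T_coeff i b (circ j a c) = sgnpow (\<beta> * (\<alpha> + \<gamma>)) (circ i (circ j a c) b)"
  "T_coeff i (circ j a b) c = sgnpow ((\<alpha> + \<beta>) * \<gamma>) (circ i c (circ j a b))"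
  "T_coeff i a (constant_coeff c b) = sgnpow (\<alpha> * (\<beta> + \<gamma>)) (circ i (constant_coeff c b) a)"
  "T_coeff i b (constant_coeff c a) = sgnpow (\<beta> * (\<alpha> + \<gamma>)) (circ i (constant_coeff c a) b)"
  "T_coeff i (constant_coeff a b) c = sgnpow ((\<alpha> + \<beta>) * \<gamma>) (circ i c (constant_coeff a b))"
  by (rule skew_homogeneous(1); fact hom product_grades)+

lemma lambda_products:
  "lambda_coeff i a b = circ i a b + sgnpow (\<alpha> * \<beta>) (circ i b a)"
  "lambda_coeff i a c = circ i a c + sgnpow (\<alpha> * \<gamma>) (circ i c a)"
  "lambda_coeff i a (circ j c b)
    = circ i a (circ j c b) + sgnpow (\<alpha> * (\<beta> + \<gamma>)) (circ i (circ j c b) a)"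
  unfolding T_products[symmetric] by (rule skew_homogeneous(2); fact hom product_grades)+

lemma constant_products:
  "constant_coeff a (circ j c b) = - sgnpow (\<alpha> * (\<beta> + \<gamma>)) (constant_coeff (circ j c b) a)"
  "constant_coeff b (circ j c a) = - sgnpow (\<beta> * (\<alpha> + \<gamma>)) (constant_coeff (circ j c a) b)"
  "constant_coeff b c = - sgnpow (\<beta> * \<gamma>) (constant_coeff c b)"
  "constant_coeff a c = - sgnpow (\<alpha> * \<gamma>) (constant_coeff c a)"
  by (rule skew_homogeneous(3); fact hom product_grades)+

lemmas nested_products = T_products lambda_products constant_products

text \<open>
  The coefficient of \<open>T\<^sub>iT\<^sub>j\<close>, multiplied by a sign that turns both sides into left-normed products of the
  \<open>\<circ>\<^sub>i\<close>.
\<close>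

lemma right_commute_homogeneous:
  "circ i (circ i c a) b = sgnpow (\<alpha> * \<beta>) (circ i (circ i c b) a)"
  "circ i (circ j c a) b + circ j (circ i c a) b
    = sgnpow (\<alpha> * \<beta>) (circ i (circ j c b) a + circ j (circ i c b) a)"
proof -
  have ab: "sgnpow (\<alpha> * \<gamma> + \<beta> * \<gamma>) (T_coeff i a (T_coeff j b c)) = sgnpow (\<alpha> * \<beta>) (circ i (circ j c b) a)"
    and ba: "sgnpow (\<alpha> * \<gamma> + \<beta> * \<gamma>) (sgnpow (\<alpha> * \<beta>) (T_coeff i b (T_coeff j a c))) = circ i (circ j c a) b"
    for i j
    by (cases \<alpha>; cases \<beta>; cases \<gamma>; simp add: nested_products coefficient_simps bit_1_plus_1)+
  show "circ i (circ i c a) b = sgnpow (\<alpha> * \<beta>) (circ i (circ i c b) a)"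
    using arg_cong[OF jacobi_homogeneous(2), of "sgnpow (\<alpha> * \<gamma> + \<beta> * \<gamma>)" i] by (simp only: ab ba)
  show "circ i (circ j c a) b + circ j (circ i c a) b
    = sgnpow (\<alpha> * \<beta>) (circ i (circ j c b) a + circ j (circ i c b) a)"
    using arg_cong[OF jacobi_homogeneous(1), of "sgnpow (\<alpha> * \<gamma> + \<beta> * \<gamma>)" i j]
    by (simp only: sgnpow_simps ab ba)
qed

text \<open>
  The coefficient of \<open>\<lambda>\<^sub>iT\<^sub>j\<close> contains, besides the terms of left symmetry for \<open>a\<close>, \<open>c\<close> and \<open>b\<close>, the two
  sides of right commutativity, which cancel.
\<close>

lemma left_symmetric_homogeneous:
  "circ i a (circ j c b) - circ j (circ i a c) b
    = sgnpow (\<alpha> * \<gamma>) (circ j c (circ i a b) - circ i (circ j c a) b)"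
proof -
  have "sgnpow (\<beta> * \<gamma>) (lambda_coeff i a (T_coeff j b c) + T_coeff j a (T_coeff i b c))
      = circ i a (circ j c b) + sgnpow (\<alpha> * \<beta> + \<alpha> * \<gamma>) (circ i (circ j c b) a + circ j (circ i c b) a)"
    and "sgnpow (\<beta> * \<gamma>) (T_coeff j (lambda_coeff i a b - T_coeff i a b) c
        + sgnpow (\<alpha> * \<beta>) (T_coeff j b (lambda_coeff i a c)))
      = sgnpow (\<alpha> * \<gamma>) (circ j c (circ i a b)) + circ j (circ i a c) b + sgnpow (\<alpha> * \<gamma>) (circ j (circ i c a) b)"
    by (cases \<alpha>; cases \<beta>; cases \<gamma>; simp add: nested_products coefficient_simps bit_1_plus_1 algebra_simps)+
  then have "circ i a (circ j c b) + sgnpow (\<alpha> * \<beta> + \<alpha> * \<gamma>) (circ i (circ j c b) a + circ j (circ i c b) a)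
      = sgnpow (\<alpha> * \<gamma>) (circ j c (circ i a b)) + circ j (circ i a c) b + sgnpow (\<alpha> * \<gamma>) (circ j (circ i c a) b)"
    by (simp only: jacobi_homogeneous(3))
  moreover have "sgnpow (\<alpha> * \<beta> + \<alpha> * \<gamma>) (circ i (circ j c b) a + circ j (circ i c b) a)
      = sgnpow (\<alpha> * \<gamma>) (circ i (circ j c a) b + circ j (circ i c a) b)"
    unfolding right_commute_homogeneous(2)
    by (cases \<alpha>; cases \<beta>; cases \<gamma>; simp add: bit_1_plus_1)+
  ultimately show ?thesis by (simp add: algebra_simps)
qed

text \<open>
  The coefficient of \<open>T\<^sub>i\<close>.  Here \<open>c\<close> becomes the left factor of \<open>\<circ>\<^sub>i\<close> because \<open>u\<^sub>i\<close> is the super-opposite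
  product.
\<close>

lemma compat_homogeneous:
  "constant_coeff (circ i c a) b + circ i (constant_coeff c a) b - circ i c (constant_coeff a b)
    - sgnpow (\<alpha> * \<beta>) (constant_coeff (circ i c b) a) - sgnpow (\<alpha> * \<beta>) (circ i (constant_coeff c b) a) = 0"
proof -
  have "sgnpow ((\<alpha> + \<beta>) * \<gamma>) (constant_coeff a (T_coeff i b c) + T_coeff i a (constant_coeff b c))
      = - sgnpow (\<alpha> * \<beta>) (constant_coeff (circ i c b) a) - sgnpow (\<alpha> * \<beta>) (circ i (constant_coeff c b) a)"
    and "sgnpow ((\<alpha> + \<beta>) * \<gamma>) (T_coeff i (constant_coeff a b) c
        + sgnpow (\<alpha> * \<beta>) (constant_coeff b (T_coeff i a c) + T_coeff i b (constant_coeff a c)))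
      = circ i c (constant_coeff a b) - constant_coeff (circ i c a) b - circ i (constant_coeff c a) b"
    by (cases \<alpha>; cases \<beta>; cases \<gamma>; simp add: nested_products coefficient_simps bit_1_plus_1 algebra_simps)+
  then have "- sgnpow (\<alpha> * \<beta>) (constant_coeff (circ i c b) a) - sgnpow (\<alpha> * \<beta>) (circ i (constant_coeff c b) a)
      = circ i c (constant_coeff a b) - constant_coeff (circ i c a) b - circ i (constant_coeff c a) b"
    by (simp only: jacobi_homogeneous(4))
  then show ?thesis by (simp add: algebra_simps)
qed

end

lemma generalized_gelfand_dorfman:
  "generalized_super_gelfand_dorfman_algebra scale V constant_coeff circ"
proof (intro generalized_super_gelfand_dorfman_algebra.intro super_gelfand_dorfman_bialgebra.intro
    super_gelfand_dorfman_bialgebra_axioms.intro lie_superalgebra.intro lie_superalgebra_axioms.intro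
    novikov_superalgebra.intro novikov_superalgebra_axioms.intro graded_circ graded_constant_coeff)
  fix \<alpha> \<beta> a b assume hom: "a \<in> V \<alpha>" "b \<in> V \<beta>"
  show "constant_coeff a b = - sgnpow (\<alpha> * \<beta>) (constant_coeff b a)"
    by (rule skew_homogeneous(3)[OF hom])
  show "constant_coeff a (constant_coeff b c)
      = constant_coeff (constant_coeff a b) c + sgnpow (\<alpha> * \<beta>) (constant_coeff b (constant_coeff a c))" for c
  proof (rule V.additive_ext[where x = c and f = "\<lambda>c. constant_coeff a (constant_coeff b c)"
      and g = "\<lambda>c. constant_coeff (constant_coeff a b) c + sgnpow (\<alpha> * \<beta>) (constant_coeff b (constant_coeff a c))"])
    show "constant_coeff a (constant_coeff b c)
      = constant_coeff (constant_coeff a b) c + sgnpow (\<alpha> * \<beta>) (constant_coeff b (constant_coeff a c))" if "c \<in> V \<delta>" for \<delta> c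
      by (rule jacobi_homogeneous(5)[OF hom that])
  qed (simp_all add: additive_def coefficient_simps algebra_simps)
  show "circ i a (circ j b c) - circ j (circ i a b) c
      = sgnpow (\<alpha> * \<beta>) (circ j b (circ i a c) - circ i (circ j b a) c)" for i j c
  proof (rule V.additive_ext[where x = c and f = "\<lambda>c. circ i a (circ j b c) - circ j (circ i a b) c"
      and g = "\<lambda>c. sgnpow (\<alpha> * \<beta>) (circ j b (circ i a c) - circ i (circ j b a) c)"])
    show "circ i a (circ j b c) - circ j (circ i a b) c
      = sgnpow (\<alpha> * \<beta>) (circ j b (circ i a c) - circ i (circ j b a) c)" if "c \<in> V \<delta>" for \<delta> c
      by (rule left_symmetric_homogeneous[OF hom(1) that hom(2)])
  qed (simp_all add: additive_def coefficient_simps algebra_simps)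
  show "circ j (circ i c a) b + circ i (circ j c a) b
      = sgnpow (\<alpha> * \<beta>) (circ j (circ i c b) a + circ i (circ j c b) a)" for i j c
  proof (rule V.additive_ext[where x = c and f = "\<lambda>c. circ j (circ i c a) b + circ i (circ j c a) b"
      and g = "\<lambda>c. sgnpow (\<alpha> * \<beta>) (circ j (circ i c b) a + circ i (circ j c b) a)"])
    show "circ j (circ i c a) b + circ i (circ j c a) b
      = sgnpow (\<alpha> * \<beta>) (circ j (circ i c b) a + circ i (circ j c b) a)" if "c \<in> V \<delta>" for \<delta> c
      by (rule right_commute_homogeneous(2)[OF hom that])
  qed (simp_all add: additive_def coefficient_simps algebra_simps)
next
  fix i \<alpha> \<beta> \<gamma> a b c assume hom: "a \<in> V \<alpha>" "b \<in> V \<beta>" "c \<in> V \<gamma>"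
  show "circ i (circ i a b) c = sgnpow (\<beta> * \<gamma>) (circ i (circ i a c) b)"
    by (rule right_commute_homogeneous(1)[OF hom(2,3,1)])
  show "circ i (circ i a b) c - circ i a (circ i b c)
      = sgnpow (\<alpha> * \<beta>) (circ i (circ i b a) c - circ i b (circ i a c))"
    using left_symmetric_homogeneous[OF hom(1,3,2), of i i] by (simp add: algebra_simps)
next
  fix i \<beta> \<gamma> a b c assume hom: "b \<in> V \<beta>" "c \<in> V \<gamma>"
  show "constant_coeff (circ i a b) c + circ i (constant_coeff a b) c - circ i a (constant_coeff b c)
      - sgnpow (\<beta> * \<gamma>) (constant_coeff (circ i a c) b) - sgnpow (\<beta> * \<gamma>) (circ i (constant_coeff a c) b)
      = 0"
  proof (rule V.additive_ext[where x = a and f = "\<lambda>a. constant_coeff (circ i a b) c + circ i (constant_coeff a b) c - circ i a (constant_coeff b c)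
      - sgnpow (\<beta> * \<gamma>) (constant_coeff (circ i a c) b) - sgnpow (\<beta> * \<gamma>) (circ i (constant_coeff a c) b)"
      and g = "\<lambda>a. 0"])
    show "constant_coeff (circ i a b) c + circ i (constant_coeff a b) c - circ i a (constant_coeff b c)
      - sgnpow (\<beta> * \<gamma>) (constant_coeff (circ i a c) b) - sgnpow (\<beta> * \<gamma>) (circ i (constant_coeff a c) b)
      = 0" if "a \<in> V \<delta>" for \<delta> a
      by (rule compat_homogeneous[OF hom that])
  qed (simp_all add: additive_def coefficient_simps algebra_simps)
qed

lemma corresponds_circ: "corresponds V br constant_coeff circ"
proof -
  have "br (const a) (const b) = linear_form (\<lambda>i. circ i a b + sgnpow (\<alpha> * \<beta>) (circ i b a))
      (\<lambda>j. sgnpow (\<alpha> * \<beta>) (circ j b a)) (constant_coeff a b)"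
    if "a \<in> V \<alpha>" "b \<in> V \<beta>" for \<alpha> \<beta> a b
    unfolding bracket_generators skew_homogeneous(2)[OF that]
    by (simp only: skew_homogeneous(1)[OF that])
  then show ?thesis unfolding corresponds_def by blast
qed

end

lemma operations_unique:
  assumes "generalized_super_gelfand_dorfman_algebra scale V lie nov"
    "generalized_super_gelfand_dorfman_algebra scale V lie' nov'"
    and "corresponds V br lie nov" "corresponds V br lie' nov'"
  shows "lie = lie'" "nov = nov'"
proof -
  interpret A: generalized_super_gelfand_dorfman_algebra scale V lie nov by fact
  interpret B: generalized_super_gelfand_dorfman_algebra scale V lie' nov' by fact
  have eq: "lie a b = lie' a b" "nov i b a = nov' i b a" if "a \<in> V \<alpha>" "b \<in> V \<beta>" for a b \<alpha> \<beta> i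
  proof -
    have form: "linear_form (\<lambda>i. nov i a b + sgnpow (\<alpha> * \<beta>) (nov i b a)) (\<lambda>j. sgnpow (\<alpha> * \<beta>) (nov j b a)) (lie a b)
      = linear_form (\<lambda>i. nov' i a b + sgnpow (\<alpha> * \<beta>) (nov' i b a)) (\<lambda>j. sgnpow (\<alpha> * \<beta>) (nov' j b a)) (lie' a b)"
      by (rule trans[OF correspondsD[OF assms(3) that, symmetric] correspondsD[OF assms(4) that]])
    show "lie a b = lie' a b"
      using arg_cong[OF form, of "\<lambda>P. Poly_Mapping.lookup (Poly_Mapping.lookup P 0) 0"]
      unfolding linear_form_coefficients .
    show "nov i b a = nov' i b a"
      using arg_cong[OF form, of "\<lambda>P. Poly_Mapping.lookup (Poly_Mapping.lookup P 0) (Poly_Mapping.single i 1)"]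
      unfolding linear_form_coefficients by (simp add: sgnpow_def split: if_splits)
  qed
  show "lie = lie'"
  proof (intro HOL.ext)
    fix a b
    show "lie a b = lie' a b"
      by (rule A.bialgebra.biadditive_ext[where f = lie and g = lie'])
        (simp_all add: additive_def A.bilinear_simps B.bilinear_simps eq(1))
  qed
  show "nov = nov'"
  proof (intro HOL.ext)
    fix i a b
    show "nov i a b = nov' i a b"
      by (rule A.bialgebra.biadditive_ext[where f = "nov i" and g = "nov' i"])
        (simp_all add: additive_def A.bilinear_simps B.bilinear_simps eq(2))
  qed
qed

theorem theorem3p13:
  fixes scale :: "complex \<Rightarrow> 'v::ab_group_add \<Rightarrow> 'v"
    and V :: "bit \<Rightarrow> 'v set"
  assumes "graded_module scale V"
  shows
    "(\<forall>br :: ('r::finite, 'v) pol \<Rightarrow> ('r, 'v) pol \<Rightarrow> ('r, ('r, 'v) pol) pol.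
        linear_lie_conformal_superalgebra scale V br \<longrightarrow>
        (\<exists>!(op :: ('v \<Rightarrow> 'v \<Rightarrow> 'v) \<times> ('r \<Rightarrow> 'v \<Rightarrow> 'v \<Rightarrow> 'v)).
           generalized_super_gelfand_dorfman_algebra scale V (fst op) (snd op) \<and>
           corresponds V br (fst op) (snd op)))
     \<and> (\<forall>(lie :: 'v \<Rightarrow> 'v \<Rightarrow> 'v) (nov :: 'r \<Rightarrow> 'v \<Rightarrow> 'v \<Rightarrow> 'v).
        generalized_super_gelfand_dorfman_algebra scale V lie nov \<longrightarrow>
        (\<exists>!(br :: ('r, 'v) pol \<Rightarrow> ('r, 'v) pol \<Rightarrow> ('r, ('r, 'v) pol) pol).
           linear_lie_conformal_superalgebra scale V br \<and> corresponds V br lie nov))"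
proof (intro conjI allI impI)
  fix br :: "('r, 'v) pol \<Rightarrow> ('r, 'v) pol \<Rightarrow> ('r, ('r, 'v) pol) pol"
  assume "linear_lie_conformal_superalgebra scale V br"
  then interpret linear_lie_conformal_superalgebra scale V br .
  show "\<exists>!(op :: ('v \<Rightarrow> 'v \<Rightarrow> 'v) \<times> ('r \<Rightarrow> 'v \<Rightarrow> 'v \<Rightarrow> 'v)).
      generalized_super_gelfand_dorfman_algebra scale V (fst op) (snd op) \<and>
      corresponds V br (fst op) (snd op)"
  proof (rule ex1I)
    show "generalized_super_gelfand_dorfman_algebra scale V (fst (constant_coeff, circ)) (snd (constant_coeff, circ)) \<and>
      corresponds V br (fst (constant_coeff, circ)) (snd (constant_coeff, circ))"
      by (simp add: generalized_gelfand_dorfman corresponds_circ)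
  next
    fix op' :: "('v \<Rightarrow> 'v \<Rightarrow> 'v) \<times> ('r \<Rightarrow> 'v \<Rightarrow> 'v \<Rightarrow> 'v)"
    assume "generalized_super_gelfand_dorfman_algebra scale V (fst op') (snd op') \<and>
      corresponds V br (fst op') (snd op')"
    then show "op' = (constant_coeff, circ)"
      using operations_unique[OF _ generalized_gelfand_dorfman _ corresponds_circ]
      by (metis prod.collapse)
  qed
next
  fix lie :: "'v \<Rightarrow> 'v \<Rightarrow> 'v" and nov :: "'r \<Rightarrow> 'v \<Rightarrow> 'v \<Rightarrow> 'v"
  assume "generalized_super_gelfand_dorfman_algebra scale V lie nov"
  then interpret generalized_super_gelfand_dorfman_algebra scale V lie nov .
  show "\<exists>!br. linear_lie_conformal_superalgebra scale V br \<and> corresponds V br lie nov"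
    using linear_lie_conformal_superalgebra_bracket corresponds_bracket bracket_unique by blast
qed

end
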